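(* Let $n$ be an odd number. The elements of $\mathrm{Sub}(n)$ are in one-to-one correspondence with the conjugacy classes in $GL(n,\mathbb{Z})$ of images of integral representations $\varrho:\mathbb{Z}_2^{n-1}\to GL(n,\mathbb{Z})$ which are equivalent to the diagonal representation $\varrho_{diag}$ over $\mathbb{Q}$.
   Context: $\varrho_{diag}:\mathbb{Z}_2^{n-1}\to SL_n(\mathbb{Z})$ is a faithful representation whose image consists of diagonal matrices (so the image is the group of all diagonal matrices with entries $\pm1$ and determinant $1$). Let $G=\langle t_1,\ldots,t_n\rangle\cong\mathbb{Z}_2^n$ with generators $t_1,\ldots,t_n$. Two subgroups $W_1,W_2<G$ are equivalent, $W_1\sim W_2$, if there exists $\sigma\in S_n$ such that the map $h_\sigma:G\to G$ defined by $h_\sigma(t_i)=t_{\sigma(i)}$ restricts to an isomorphism from $W_1$ to $W_2$. Then $$\mathrm{Sub}(n)=\{W<G : t_i\notin W \text{ for all } i\in\{1,\ldots,n\}\}/\sim.$$ *)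

theory Defs
  imports
    "HOL-Algebra.Product_Groups"
    "HOL-Combinatorics.Permutations"
    "Jordan_Normal_Form.Determinant"
begin

definition Z2_pow :: "nat \<Rightarrow> (nat \<Rightarrow> int) monoid" where
  "Z2_pow k = product_group {1..k} (\<lambda>_. integer_mod_group 2)"

definition t_gen :: "nat \<Rightarrow> nat \<Rightarrow> nat \<Rightarrow> int" where
  "t_gen n i = (\<lambda>j\<in>{1..n}. of_bool (j = i))"

definition Sub_equiv :: "nat \<Rightarrow> ((nat \<Rightarrow> int) set \<times> (nat \<Rightarrow> int) set) set" where
  "Sub_equiv n = {(W1, W2). subgroup W1 (Z2_pow n) \<and> subgroup W2 (Z2_pow n) \<and>
     (\<exists>\<sigma> h. \<sigma> permutes {1..n} \<and> h \<in> hom (Z2_pow n) (Z2_pow n) \<and>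
        (\<forall>i\<in>{1..n}. h (t_gen n i) = t_gen n (\<sigma> i)) \<and>
        h \<in> iso ((Z2_pow n)\<lparr>carrier := W1\<rparr>) ((Z2_pow n)\<lparr>carrier := W2\<rparr>))}"

definition Sub :: "nat \<Rightarrow> (nat \<Rightarrow> int) set set set" where
  "Sub n = {W. subgroup W (Z2_pow n) \<and> (\<forall>i\<in>{1..n}. t_gen n i \<notin> W)} // Sub_equiv n"

text \<open>The extension slot of \<^const>\<open>ring_mat\<close> is irrelevant here and filled with the unit value.\<close>

definition GL :: "'a::comm_ring_1 itself \<Rightarrow> nat \<Rightarrow> 'a mat monoid" where
  "GL ty n = units_of (ring_mat ty n ())"

definition SL :: "'a::comm_ring_1 itself \<Rightarrow> nat \<Rightarrow> 'a mat monoid" where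
  "SL ty n = (GL ty n)\<lparr>carrier := {A \<in> carrier (GL ty n). det A = 1}\<rparr>"

definition is_diag_rep :: "nat \<Rightarrow> ((nat \<Rightarrow> int) \<Rightarrow> int mat) \<Rightarrow> bool" where
  "is_diag_rep n \<rho> \<longleftrightarrow> \<rho> \<in> hom (Z2_pow (n - 1)) (SL TYPE(int) n) \<and>
     inj_on \<rho> (carrier (Z2_pow (n - 1))) \<and>
     (\<forall>g\<in>carrier (Z2_pow (n - 1)). diagonal_mat (\<rho> g))"

definition rationally_equivalent ::
    "nat \<Rightarrow> ('g, 'b) monoid_scheme \<Rightarrow> ('g \<Rightarrow> int mat) \<Rightarrow> ('g \<Rightarrow> int mat) \<Rightarrow> bool" where
  "rationally_equivalent n G \<rho> \<rho>' \<longleftrightarrow>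
     (\<exists>P\<in>carrier (GL TYPE(rat) n). \<forall>g\<in>carrier G.
        map_mat of_int (\<rho>' g) =
          P \<otimes>\<^bsub>GL TYPE(rat) n\<^esub> map_mat of_int (\<rho> g) \<otimes>\<^bsub>GL TYPE(rat) n\<^esub> inv\<^bsub>GL TYPE(rat) n\<^esub> P)"

definition conj_subgroups :: "('a, 'b) monoid_scheme \<Rightarrow> ('a set \<times> 'a set) set" where
  "conj_subgroups G = {(H, K). subgroup H G \<and> subgroup K G \<and>
     (\<exists>a\<in>carrier G. K = a <#\<^bsub>G\<^esub> H #>\<^bsub>G\<^esub> inv\<^bsub>G\<^esub> a)}"

text \<open>Since the conjugacy relation lives on all subgroups of \<open>GL(n, \<int>)\<close>, the elements of the
  following quotient are full conjugacy classes of subgroups.\<close>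

definition image_classes :: "nat \<Rightarrow> ((nat \<Rightarrow> int) \<Rightarrow> int mat) \<Rightarrow> int mat set set set" where
  "image_classes n \<rho>\<^sub>d =
     {\<rho> ` carrier (Z2_pow (n - 1)) | \<rho>.
        \<rho> \<in> hom (Z2_pow (n - 1)) (GL TYPE(int) n) \<and>
        rationally_equivalent n (Z2_pow (n - 1)) \<rho> \<rho>\<^sub>d}
     // conj_subgroups (GL TYPE(int) n)"

end

theory Submission
  imports Defs
begin

text \<open>
  The group of images is the group \<open>D\<close> of diagonal sign matrices of determinant 1. An integral form
  of \<open>\<rho>_diag\<close> amounts to a \<open>D\<close>-invariant lattice \<open>L\<close> in \<open>\<rat>\<^sup>n\<close>, up to isomorphism of lattices normalising
  \<open>D\<close>. As \<open>n\<close> is odd, \<open>D\<close> contains the matrices \<open>d\<^sub>i\<close> with entry 1 at \<open>i\<close> and -1 elsewhere, so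
  \<open>x + d\<^sub>i x = 2 x\<^sub>i e\<^sub>i\<close> lies in \<open>L\<close> for \<open>x\<close> in \<open>L\<close>. After rescaling the coordinates such that
  \<open>L \<inter> \<rat> e\<^sub>i = 2 \<int> e\<^sub>i\<close>, the lattice satisfies \<open>2 \<int>\<^sup>n \<subseteq> L \<subseteq> \<int>\<^sup>n\<close>, hence it is the preimage of the
  subgroup \<open>W = L / 2 \<int>\<^sup>n\<close> of \<open>\<int>\<^sub>2\<^sup>n\<close>, and \<open>W\<close> contains no \<open>t\<^sub>i\<close>. A matrix normalising \<open>D\<close> is monomial,
  and if it maps one such lattice onto another, its nonzero entries are odd, so that modulo 2 it acts
  as a permutation of the coordinates.
\<close>

subsection \<open>Integral matrices and lattices\<close>

text \<open>Two points decide the form of the argument. Secondly, a lattice yields a group of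
  integral matrices only after the choice of a basis; hence subgroups and images are linked by a
  relation, and independence of the basis is absorbed into conjugacy. The lattice arguments stay
  integral: a basis is an integer matrix \<open>B\<close>, conjugation by its inverse becomes the
  equation \<open>B * A = d * B\<close>, and where an inverse is unavoidable its double is used,
  which is integral because the lattice contains \<open>2 \<int>\<^sup>n\<close>.\<close>

lemma mult_mat_left_cancel:
  fixes B :: "'a::idom mat"
  assumes B: "B \<in> carrier_mat n n" and "det B \<noteq> 0"
    and X: "X \<in> carrier_mat n m" and Y: "Y \<in> carrier_mat n m" and eq: "B * X = B * Y"
  shows "X = Y"
proof -
  \<comment> \<open>The adjugate acts as an inverse up to the factor \<open>det B\<close>, so
    cancellation also works for integral matrices that are not unimodular.\<close>
  have *: "adj_mat B * (B * Z) = det B \<cdot>\<^sub>m Z" if "Z \<in> carrier_mat n m" for Z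
    using adj_mat[OF B] that B
    by (simp flip: assoc_mult_mat[of _ n n _ n _ m] add: mult_smult_assoc_mat[of _ n n _ m])
  have "det B \<cdot>\<^sub>m X = det B \<cdot>\<^sub>m Y"
    using *[OF X] *[OF Y] eq by simp
  then have "det B * X $$ (i, j) = det B * Y $$ (i, j)" if "i < n" "j < m" for i j
    using that X Y by (metis carrier_matD index_smult_mat(1))
  then show ?thesis
    using X Y \<open>det B \<noteq> 0\<close> by (intro eq_matI) auto
qed

lemma mult_mat_right_cancel:
  fixes B :: "'a::idom mat"
  assumes B: "B \<in> carrier_mat n n" and "det B \<noteq> 0"
    and X: "X \<in> carrier_mat m n" and Y: "Y \<in> carrier_mat m n" and eq: "X * B = Y * B"
  shows "X = Y"
proof -
  have *: "Z * B * adj_mat B = det B \<cdot>\<^sub>m Z" if "Z \<in> carrier_mat m n" for Z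
    using adj_mat[OF B] that B
    by (simp add: assoc_mult_mat[of _ m n _ n _ n] mult_smult_distrib[of _ m n _ n])
  have "det B \<cdot>\<^sub>m X = det B \<cdot>\<^sub>m Y"
    using *[OF X] *[OF Y] eq by simp
  then have "det B * X $$ (i, j) = det B * Y $$ (i, j)" if "i < m" "j < n" for i j
    using that X Y by (metis carrier_matD index_smult_mat(1))
  then show ?thesis
    using X Y \<open>det B \<noteq> 0\<close> by (intro eq_matI) auto
qed

lemma det_nonzero_if_mult_eq_smult_one:
  fixes A :: "'a::idom mat"
  assumes A: "A \<in> carrier_mat n n" and B: "B \<in> carrier_mat n n"
    and eq: "A * B = k \<cdot>\<^sub>m 1\<^sub>m n" and "k \<noteq> 0"
  shows "det A \<noteq> 0" "det B \<noteq> 0"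
proof -
  have "det A * det B = k ^ n"
    using det_mult[OF A B] eq by (simp add: det_smult)
  then show "det A \<noteq> 0" "det B \<noteq> 0"
    using \<open>k \<noteq> 0\<close> by (metis mult_eq_0_iff power_not_zero)+
qed

text \<open>Both sides agree after multiplication by \<open>A\<close> from the left, as
  \<open>A(BA) = (AB)A = kA\<close>, and \<open>A\<close> has nonzero determinant.\<close>

lemma mult_eq_smult_one_commute:
  fixes A :: "'a::idom mat"
  assumes A: "A \<in> carrier_mat n n" and B: "B \<in> carrier_mat n n"
    and eq: "A * B = k \<cdot>\<^sub>m 1\<^sub>m n" and "k \<noteq> 0"
  shows "B * A = k \<cdot>\<^sub>m 1\<^sub>m n"
proof (rule mult_mat_left_cancel[of A n])
  show "A * (B * A) = A * (k \<cdot>\<^sub>m 1\<^sub>m n)"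
    using A B eq
    by (simp flip: assoc_mult_mat[of _ n n _ n _ n]
        add: mult_smult_assoc_mat[of _ n n _ n] mult_smult_distrib[of _ n n _ n])
qed (use det_nonzero_if_mult_eq_smult_one[OF A B eq \<open>k \<noteq> 0\<close>] A B in auto)

text \<open>Turns containment of lattices into divisibility of matrices: the coefficient vectors of
  the columns are assembled into the quotient.\<close>

lemma eq_mult_mat_if_cols:
  assumes B: "B \<in> carrier_mat n m" and X: "X \<in> carrier_mat n k"
    and cols: "\<And>j. j < k \<Longrightarrow> \<exists>c\<in>carrier_vec m. col X j = B *\<^sub>v c"
  shows "\<exists>Y\<in>carrier_mat m k. X = B * Y"
proof -
  obtain c where c: "\<And>j. j < k \<Longrightarrow> c j \<in> carrier_vec m \<and> col X j = B *\<^sub>v c j"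
    using cols by metis
  define Y where "Y = mat_of_cols m (map c [0..<k])"
  have Y: "Y \<in> carrier_mat m k" by (simp add: Y_def carrier_matI)
  have "col Y j = c j" if "j < k" for j
    using that c by (simp add: Y_def)
  then have "X = B * Y"
    using B X Y c by (intro mat_col_eqI) auto
  with Y show ?thesis by blast
qed

section \<open>Bases of integral lattices of full rank\<close>

lemma mult_mat_smult_vec:
  fixes A :: "'a::comm_semiring_0 mat"
  assumes "A \<in> carrier_mat n m" "v \<in> carrier_vec m"
  shows "A *\<^sub>v (k \<cdot>\<^sub>v v) = k \<cdot>\<^sub>v (A *\<^sub>v v)"
  using assms by (intro eq_vecI) auto

lemma int_subgroup_generator:
  fixes S :: "int set"
  assumes "m \<in> S" "m > 0" and diff: "\<And>x y. x \<in> S \<Longrightarrow> y \<in> S \<Longrightarrow> x - y \<in> S"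
  obtains a where "a > 0" "a \<in> S" "\<And>x. x \<in> S \<Longrightarrow> a dvd x"
proof -
  define k where "k = (LEAST k. k > 0 \<and> int k \<in> S)"
  have ex: "nat m > 0 \<and> int (nat m) \<in> S" using assms by auto
  have k: "k > 0" "int k \<in> S"
    using LeastI[of "\<lambda>k. k > 0 \<and> int k \<in> S", OF ex] by (auto simp: k_def)
  have zero: "0 \<in> S" using diff[OF k(2) k(2)] by simp
  have neg: "- x \<in> S" if "x \<in> S" for x using diff[OF zero that] by simp
  have add: "x + y \<in> S" if "x \<in> S" "y \<in> S" for x y using diff[OF that(1) neg[OF that(2)]] by simp
  have nat: "int i * int k \<in> S" for i
    by (induction i) (auto simp: zero distrib_right intro: add k)
  have mult: "q * int k \<in> S" for q
    using nat[of "nat q"] neg[OF nat[of "nat (- q)"]] by (cases "q \<ge> 0") auto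
  have "int k dvd x" if "x \<in> S" for x
  proof (rule ccontr)
    assume "\<not> int k dvd x"
    then have "x mod int k \<noteq> 0" by (simp add: dvd_eq_mod_eq_0)
    moreover have "x mod int k \<ge> 0" using k by simp
    ultimately have pos: "x mod int k > 0" by linarith
    have "x mod int k \<in> S"
      using diff[OF that mult[of "x div int k"]] by (simp add: minus_div_mult_eq_mod)
    then have "k \<le> nat (x mod int k)"
      using pos Least_le[of "\<lambda>k. k > 0 \<and> int k \<in> S" "nat (x mod int k)"] by (simp add: k_def)
    moreover have "x mod int k < int k" using k by simp
    ultimately show False using pos by linarith
  qed
  with k that show ?thesis by (metis of_nat_0_less_iff)
qed

text \<open>Differences yield negatives and sums, hence all integer multiples of unit vectors; a
  vector is then built up through its truncations. This is used to check additive statements on unit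
  vectors only.\<close>

lemma int_vec_closed_induct:
  fixes P :: "int vec \<Rightarrow> bool"
  assumes diff: "\<And>x y. x \<in> carrier_vec n \<Longrightarrow> y \<in> carrier_vec n \<Longrightarrow> P x \<Longrightarrow> P y \<Longrightarrow> P (x - y)"
    and zero: "P (0\<^sub>v n)" and unit: "\<And>i. i < n \<Longrightarrow> P (unit_vec n i)" and x: "x \<in> carrier_vec n"
  shows "P x"
proof -
  have neg: "P (- v)" if "v \<in> carrier_vec n" "P v" for v
    using diff[OF _ that(1) zero that(2)] that(1) by simp
  have add: "P (v + w)" if "v \<in> carrier_vec n" "w \<in> carrier_vec n" "P v" "P w" for v w
    using diff[OF that(1) _ that(3) neg[OF that(2,4)]] that
    by (metis minus_add_uminus_vec uminus_carrier_vec uminus_uminus_vec)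
  have nat: "P (int m \<cdot>\<^sub>v unit_vec n i)" if "i < n" for m i
  proof (induction m)
    case 0
    have "(0::int) \<cdot>\<^sub>v unit_vec n i = 0\<^sub>v n" by auto
    then show ?case using zero by simp
  next
    case (Suc m)
    have "int (Suc m) \<cdot>\<^sub>v unit_vec n i = unit_vec n i + int m \<cdot>\<^sub>v unit_vec n i"
      by (intro eq_vecI) (auto simp: distrib_right)
    then show ?case using Suc unit[OF that] by (auto intro!: add)
  qed
  have smult: "P (a \<cdot>\<^sub>v unit_vec n i)" if "i < n" for a i
  proof (cases "a \<ge> 0")
    case True
    then show ?thesis using nat[OF that, of "nat a"] by simp
  next
    case False
    have "a \<cdot>\<^sub>v unit_vec n i = - (int (nat (- a)) \<cdot>\<^sub>v unit_vec n i)"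
      using False by (intro eq_vecI) auto
    then show ?thesis using neg[OF _ nat[OF that, of "nat (- a)"]] by simp
  qed
  have "P (vec n (\<lambda>i. if i < k then x $ i else 0))" if "k \<le> n" for k
    using that
  proof (induction k)
    case 0
    have "vec n (\<lambda>i. if i < 0 then x $ i else 0) = 0\<^sub>v n" by auto
    then show ?case using zero by simp
  next
    case (Suc k)
    have "vec n (\<lambda>i. if i < Suc k then x $ i else 0) =
        vec n (\<lambda>i. if i < k then x $ i else 0) + x $ k \<cdot>\<^sub>v unit_vec n k"
      using Suc.prems by (intro eq_vecI) (auto simp: less_Suc_eq)
    then show ?case using Suc by (auto intro!: add smult)
  qed
  from this[of n] have "P (vec n (\<lambda>i. if i < n then x $ i else 0))" by simp
  moreover have "vec n (\<lambda>i. if i < n then x $ i else 0) = x"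
    using x by (intro eq_vecI) auto
  ultimately show ?thesis by simp
qed

text \<open>The basis is triangular: the \<open>i\<close>-th vector generates the \<open>i\<close>-th coordinates of those lattice
  vectors whose earlier coordinates vanish.\<close>

lemma full_rank_lattice_basis:
  fixes M :: "int vec set"
  assumes M: "M \<subseteq> carrier_vec n" and diff: "\<And>x y. x \<in> M \<Longrightarrow> y \<in> M \<Longrightarrow> x - y \<in> M"
    and "m > 0" and unit: "\<And>i. i < n \<Longrightarrow> m \<cdot>\<^sub>v unit_vec n i \<in> M" and zero: "0\<^sub>v n \<in> M"
  shows "\<exists>B\<in>carrier_mat n n. M = (\<lambda>c. B *\<^sub>v c) ` carrier_vec n"
proof -
  have "\<exists>b\<in>M. (\<forall>j<i. b $ j = 0) \<and> (\<forall>x\<in>M. (\<forall>j<i. x $ j = 0) \<longrightarrow> b $ i dvd x $ i)" if "i < n" for i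
  proof -
    define S where "S = (\<lambda>x. x $ i) ` {x \<in> M. \<forall>j<i. x $ j = 0}"
    \<comment> \<open>This is where full rank enters: \<open>S\<close>, the set of possible leading
      coefficients, is not zero.\<close>
    have "m \<in> S"
      unfolding S_def using unit[OF that] that
      by (intro image_eqI[of _ _ "m \<cdot>\<^sub>v unit_vec n i"]) auto
    moreover have "x - y \<in> S" if xy: "x \<in> S" "y \<in> S" for x y
    proof -
      obtain v w where vw: "v \<in> M" "w \<in> M" "\<forall>j<i. v $ j = 0" "\<forall>j<i. w $ j = 0"
        "x = v $ i" "y = w $ i"
        using xy by (auto simp: S_def)
      then have "v \<in> carrier_vec n" "w \<in> carrier_vec n" using M by auto
      then show ?thesis
        unfolding S_def using vw \<open>i < n\<close> diff
        by (intro image_eqI[of _ _ "v - w"]) auto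
    qed
    ultimately obtain a where "a \<in> S" "\<And>x. x \<in> S \<Longrightarrow> a dvd x"
      using int_subgroup_generator[of m S] \<open>m > 0\<close> by metis
    then show ?thesis unfolding S_def by blast
  qed
  then obtain b where b: "\<And>i. i < n \<Longrightarrow> b i \<in> M" "\<And>i j. i < n \<Longrightarrow> j < i \<Longrightarrow> b i $ j = 0"
    "\<And>i x. i < n \<Longrightarrow> x \<in> M \<Longrightarrow> \<forall>j<i. x $ j = 0 \<Longrightarrow> b i $ i dvd x $ i"
    by metis
  have bc: "b i \<in> carrier_vec n" if "i < n" for i using b(1)[OF that] M by auto
  define B where "B = mat_of_cols n (map b [0..<n])"
  have B: "B \<in> carrier_mat n n" by (simp add: B_def carrier_matI)
  have colB: "col B i = b i" if "i < n" for i
    using that bc by (simp add: B_def)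
  have Bunit: "B *\<^sub>v unit_vec n i = b i" if "i < n" for i
  proof -
    have "B *\<^sub>v unit_vec n i = col B i"
      using that B by (intro eq_vecI) (auto simp: row_def col_def)
    then show ?thesis using colB[OF that] by simp
  qed
  have neg: "- x \<in> M" if "x \<in> M" for x using diff[OF zero that] that M by auto
  have add: "x + y \<in> M" if "x \<in> M" "y \<in> M" for x y
    using diff[OF that(1) neg[OF that(2)]] that M
    by (metis minus_add_uminus_vec subsetD uminus_carrier_vec uminus_uminus_vec)
  have BM: "B *\<^sub>v c \<in> M" if "c \<in> carrier_vec n" for c
    using that
  proof (rule int_vec_closed_induct[of n, rotated -1])
    show "B *\<^sub>v (x - y) \<in> M" if "x \<in> carrier_vec n" "y \<in> carrier_vec n" "B *\<^sub>v x \<in> M" "B *\<^sub>v y \<in> M"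
      for x y using diff that by (simp add: mult_minus_distrib_mat_vec[OF B])
    have "B *\<^sub>v 0\<^sub>v n = 0\<^sub>v n" using B by (intro eq_vecI) auto
    then show "B *\<^sub>v 0\<^sub>v n \<in> M" using zero by simp
    show "B *\<^sub>v unit_vec n i \<in> M" if "i < n" for i using Bunit b that by simp
  qed
  \<comment> \<open>Elimination: \<open>k\<close> counts leading zeros. The induction runs downwards
    from \<open>k = n\<close>, where \<open>x\<close> is zero, and its step clears coordinate
    \<open>k\<close> by a multiple of \<open>b k\<close>.\<close>
  have "\<exists>c\<in>carrier_vec n. x = B *\<^sub>v c" if "k \<le> n" "x \<in> M" "\<forall>j<k. x $ j = 0" for k x
    using that
  proof (induction k arbitrary: x rule: inc_induct)
    case base
    then have "x = 0\<^sub>v n" using M by (intro eq_vecI) auto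
    also have "\<dots> = B *\<^sub>v 0\<^sub>v n" using B by (intro eq_vecI) auto
    finally show ?case by auto
  next
    case (step k)
    have x: "x \<in> carrier_vec n" using step M by auto
    obtain q where q: "x $ k = b k $ k * q"
      using b(3)[of k x] step by (auto simp: dvd_def)
    have qb: "B *\<^sub>v (q \<cdot>\<^sub>v unit_vec n k) = q \<cdot>\<^sub>v b k"
      using Bunit[OF step(2)] by (simp add: mult_mat_smult_vec[OF B])
    have "q \<cdot>\<^sub>v b k \<in> M"
      using BM[of "q \<cdot>\<^sub>v unit_vec n k"] by (simp add: qb)
    then have "x - q \<cdot>\<^sub>v b k \<in> M" using diff step by simp
    moreover have "\<forall>j<Suc k. (x - q \<cdot>\<^sub>v b k) $ j = 0"
      using step x bc[of k] b(2)[of k] q by (auto simp: less_Suc_eq)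
    ultimately obtain c where c: "c \<in> carrier_vec n" "x - q \<cdot>\<^sub>v b k = B *\<^sub>v c"
      using step.IH by blast
    have "x = (x - q \<cdot>\<^sub>v b k) + q \<cdot>\<^sub>v b k" using x bc[of k] step by (intro eq_vecI) auto
    also have "\<dots> = B *\<^sub>v (c + q \<cdot>\<^sub>v unit_vec n k)"
      using c qb by (simp add: mult_add_distrib_mat_vec[OF B])
    finally show ?case using c(1) by (intro bexI[of _ "c + q \<cdot>\<^sub>v unit_vec n k"]) auto
  qed
  from this[of 0] have "M \<subseteq> (\<lambda>c. B *\<^sub>v c) ` carrier_vec n" by blast
  with BM B show ?thesis by blast
qed

text \<open>A relation is used because a partner in \<open>B\<close> depends on choices. From left
  to right \<open>iff\<close> makes the class of the partner independent of them, from right to left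
  it gives injectivity on classes.\<close>

lemma quotient_bij_of_relation:
  assumes r: "equiv X r" "A \<subseteq> X" and s: "equiv Y s" "B \<subseteq> Y"
    and total: "\<And>a. a \<in> A \<Longrightarrow> \<exists>b\<in>B. R a b" and onto: "\<And>b. b \<in> B \<Longrightarrow> \<exists>a\<in>A. R a b"
    and iff: "\<And>a a' b b'. a \<in> A \<Longrightarrow> a' \<in> A \<Longrightarrow> b \<in> B \<Longrightarrow> b' \<in> B \<Longrightarrow> R a b \<Longrightarrow> R a' b' \<Longrightarrow>
      (a, a') \<in> r \<longleftrightarrow> (b, b') \<in> s"
  shows "\<exists>f. bij_betw f (A // r) (B // s)"
proof -
  obtain g where g: "\<And>a. a \<in> A \<Longrightarrow> g a \<in> B \<and> R a (g a)" using total by metis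
  have cls: "s `` {g a} = s `` {g a'} \<longleftrightarrow> r `` {a} = r `` {a'}" if "a \<in> A" "a' \<in> A" for a a'
    using that g iff[OF that, of "g a" "g a'"] eq_equiv_class_iff[OF r(1), of a a']
      eq_equiv_class_iff[OF s(1), of "g a" "g a'"] r(2) s(2) by blast
  \<comment> \<open>A class in \<open>A // r\<close> may contain elements outside \<open>A\<close>,
    so the representative is chosen within \<open>A\<close>.\<close>
  define pick where "pick C = (SOME a. a \<in> A \<and> C = r `` {a})" for C
  have pick: "pick C \<in> A \<and> C = r `` {pick C}" if "C \<in> A // r" for C
    unfolding pick_def by (rule someI_ex) (use that in \<open>auto simp: quotient_def\<close>)
  have "bij_betw (\<lambda>C. s `` {g (pick C)}) (A // r) (B // s)"
  proof (rule bij_betwI')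
    show "(s `` {g (pick C)} = s `` {g (pick C')}) = (C = C')" if "C \<in> A // r" "C' \<in> A // r" for C C'
      using cls[of "pick C" "pick C'"] pick[OF that(1)] pick[OF that(2)] by auto
    show "s `` {g (pick C)} \<in> B // s" if "C \<in> A // r" for C
      using pick[OF that] g by (auto intro: quotientI)
    show "\<exists>C\<in>A // r. D = s `` {g (pick C)}" if D: "D \<in> B // s" for D
    proof -
      obtain b where b: "b \<in> B" "D = s `` {b}" using D by (auto simp: quotient_def)
      obtain a where a: "a \<in> A" "R a b" using onto b by blast
      let ?C = "r `` {a}"
      have C: "?C \<in> A // r" using a by (auto intro: quotientI)
      \<comment> \<open>Taking \<open>a\<close> twice in \<open>iff\<close> compares its two
        partners \<open>b\<close> and \<open>g a\<close>.\<close>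
      have "(a, a) \<in> r" using a r by (meson equiv_def refl_onD subsetD)
      then have "(b, g a) \<in> s" using iff[OF a(1) a(1) b(1) _ a(2)] g a by blast
      then have "D = s `` {g a}" using b s equiv_class_eq by metis
      also have "\<dots> = s `` {g (pick ?C)}"
        using cls[of a "pick ?C"] pick[OF C] a by auto
      finally show ?thesis using C by blast
    qed
  qed
  then show ?thesis by blast
qed

lemma conj_subgroups_iff:
  "(H, K) \<in> conj_subgroups G \<longleftrightarrow> subgroup H G \<and> subgroup K G \<and>
     (\<exists>a\<in>carrier G. K = (\<lambda>h. a \<otimes>\<^bsub>G\<^esub> h \<otimes>\<^bsub>G\<^esub> inv\<^bsub>G\<^esub> a) ` H)"
  by (simp add: conj_subgroups_def l_coset_def r_coset_def UNION_singleton_eq_range image_image)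

lemma (in group) equiv_conj_subgroups: "equiv {H. subgroup H G} (conj_subgroups G)"
proof (rule equivI)
  show "conj_subgroups G \<subseteq> {H. subgroup H G} \<times> {H. subgroup H G}"
    by (auto simp: conj_subgroups_def)
  show "refl_on {H. subgroup H G} (conj_subgroups G)"
  proof (rule refl_onI)
    fix H assume H: "H \<in> {H. subgroup H G}"
    then have "(\<lambda>h. \<one> \<otimes> h \<otimes> inv \<one>) ` H = H"
      by (force simp: subgroup.mem_carrier)
    then show "(H, H) \<in> conj_subgroups G"
      using H by (auto simp: conj_subgroups_iff intro!: bexI[of _ \<one>])
  qed
  show "sym (conj_subgroups G)"
  proof (rule symI)
    fix H K assume "(H, K) \<in> conj_subgroups G"
    then obtain a where a: "a \<in> carrier G" "subgroup H G" "subgroup K G"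
      "K = (\<lambda>h. a \<otimes> h \<otimes> inv a) ` H"
      by (auto simp: conj_subgroups_iff)
    have "inv a \<otimes> (a \<otimes> h \<otimes> inv a) \<otimes> inv (inv a) = h" if "h \<in> H" for h
      using a that subgroup.mem_carrier[OF a(2) that] by (simp add: m_assoc) (simp add: m_assoc[symmetric])
    then have "H = (\<lambda>h. inv a \<otimes> h \<otimes> inv (inv a)) ` K"
      by (simp add: a(4) image_image)
    then show "(K, H) \<in> conj_subgroups G"
      using a unfolding conj_subgroups_iff by blast
  qed
  show "trans (conj_subgroups G)"
  proof (rule transI)
    fix H K L assume "(H, K) \<in> conj_subgroups G" "(K, L) \<in> conj_subgroups G"
    then obtain a b where ab: "a \<in> carrier G" "b \<in> carrier G" "subgroup H G" "subgroup L G"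
      "K = (\<lambda>h. a \<otimes> h \<otimes> inv a) ` H" "L = (\<lambda>h. b \<otimes> h \<otimes> inv b) ` K"
      by (auto simp: conj_subgroups_iff)
    have "b \<otimes> (a \<otimes> h \<otimes> inv a) \<otimes> inv b = (b \<otimes> a) \<otimes> h \<otimes> inv (b \<otimes> a)" if "h \<in> H" for h
      using ab subgroup.mem_carrier[OF ab(3) that] by (simp add: m_assoc inv_mult_group)
    then have "L = (\<lambda>h. (b \<otimes> a) \<otimes> h \<otimes> inv (b \<otimes> a)) ` H"
      by (simp add: ab(5,6) image_image)
    then show "(H, L) \<in> conj_subgroups G"
      using ab unfolding conj_subgroups_iff by blast
  qed
qed

subsection \<open>Reduction modulo 2\<close>

lemma group_Z2_pow: "group (Z2_pow n)"
  by (simp add: Z2_pow_def)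

lemma carrier_Z2_pow: "carrier (Z2_pow n) = {1..n} \<rightarrow>\<^sub>E {0, 1}"
proof -
  have "{0..<2::int} = {0, 1}" by auto
  then show ?thesis by (simp add: Z2_pow_def carrier_integer_mod_group)
qed

lemma mult_Z2_pow: "f \<otimes>\<^bsub>Z2_pow n\<^esub> g = (\<lambda>j\<in>{1..n}. (f j + g j) mod 2)"
  by (simp add: Z2_pow_def)

lemma one_Z2_pow: "\<one>\<^bsub>Z2_pow n\<^esub> = (\<lambda>j\<in>{1..n}. 0)"
  by (simp add: Z2_pow_def)

lemma Z2_pow_square: "f \<otimes>\<^bsub>Z2_pow n\<^esub> f = \<one>\<^bsub>Z2_pow n\<^esub>"
  by (auto simp: mult_Z2_pow one_Z2_pow restrict_def)

lemma inv_Z2_pow: "f \<in> carrier (Z2_pow n) \<Longrightarrow> inv\<^bsub>Z2_pow n\<^esub> f = f"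
  by (meson Z2_pow_square group.inv_equality group_Z2_pow)

lemma subgroup_Z2_powI:
  assumes "W \<subseteq> carrier (Z2_pow n)" "W \<noteq> {}"
    and "\<And>f g. f \<in> W \<Longrightarrow> g \<in> W \<Longrightarrow> f \<otimes>\<^bsub>Z2_pow n\<^esub> g \<in> W"
  shows "subgroup W (Z2_pow n)"
  using assms by (intro group.subgroupI[OF group_Z2_pow]) (auto simp: inv_Z2_pow subset_iff)

text \<open>Vectors are indexed from 0, the coordinates of \<^const>\<open>Z2_pow\<close> from 1.\<close>

definition red :: "nat \<Rightarrow> int vec \<Rightarrow> nat \<Rightarrow> int" where
  "red n x = (\<lambda>j\<in>{1..n}. x $ (j - 1) mod 2)"

lemma red_in_carrier: "red n x \<in> carrier (Z2_pow n)"
  by (auto simp: red_def carrier_Z2_pow)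

lemma ex_red_eq:
  assumes "f \<in> carrier (Z2_pow n)" shows "\<exists>x\<in>carrier_vec n. red n x = f"
proof
  show "red n (vec n (\<lambda>i. f (Suc i))) = f"
  proof
    fix j
    have "j \<in> {1..n} \<Longrightarrow> f j = 0 \<or> f j = 1" "j \<notin> {1..n} \<Longrightarrow> f j = undefined"
      using assms by (auto simp: carrier_Z2_pow PiE_iff extensional_def)
    then show "red n (vec n (\<lambda>i. f (Suc i))) j = f j"
      by (cases "j \<in> {1..n}") (auto simp: red_def)
  qed
qed simp

text \<open>Modulo 2 subtraction is addition. The form with differences fits the induction principle
  \<open>int_vec_closed_induct\<close>.\<close>

lemma red_diff:
  assumes "x \<in> carrier_vec n" "y \<in> carrier_vec n"
  shows "red n (x - y) = red n x \<otimes>\<^bsub>Z2_pow n\<^esub> red n y"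
proof -
  have "(a - b) mod 2 = (a mod 2 + b mod 2) mod 2" for a b :: int by presburger
  then show ?thesis using assms by (auto simp: red_def mult_Z2_pow intro!: restrict_ext)
qed

lemma red_zero: "red n (0\<^sub>v n) = \<one>\<^bsub>Z2_pow n\<^esub>"
  by (auto simp: red_def one_Z2_pow intro!: restrict_ext)

lemma red_unit_vec: "i < n \<Longrightarrow> red n (unit_vec n i) = t_gen n (Suc i)"
  by (fastforce simp: red_def t_gen_def unit_vec_def)

lemma red_eq_iff: "red n x = red n y \<longleftrightarrow> (\<forall>i<n. x $ i mod 2 = y $ i mod 2)"
proof
  assume eq: "red n x = red n y"
  show "\<forall>i<n. x $ i mod 2 = y $ i mod 2"
  proof (intro allI impI)
    fix i assume "i < n"
    then show "x $ i mod 2 = y $ i mod 2"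
      using fun_cong[OF eq, of "Suc i"] by (simp add: red_def)
  qed
qed (auto simp: red_def intro!: restrict_ext)

lemma red_in_subgroup_diff:
  assumes W: "subgroup W (Z2_pow n)" and "x \<in> carrier_vec n" "y \<in> carrier_vec n"
    and "red n x \<in> W" "red n y \<in> W"
  shows "red n (x - y) \<in> W"
  using assms by (simp add: red_diff subgroup.m_closed[OF W])

section \<open>Coordinate permutations and the equivalence of subgroups\<close>

definition permute_vec :: "nat \<Rightarrow> (nat \<Rightarrow> nat) \<Rightarrow> 'a vec \<Rightarrow> 'a vec" where
  "permute_vec n \<tau> x = vec n (\<lambda>i. x $ \<tau> i)"

lemma permute_vec_closed [simp]: "permute_vec n \<tau> x \<in> carrier_vec n"
  by (simp add: permute_vec_def)

lemma permutes_lessThan_iff: "\<tau> permutes {..<n} \<Longrightarrow> \<tau> i < n \<longleftrightarrow> i < n"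
  using permutes_in_image[of \<tau> "{..<n}" i] by simp

text \<open>Indices are pulled back: the unit vector at \<open>\<tau> i\<close> goes to the one at
  \<open>i\<close>. Therefore the order of composition reverses, and a permutation of the generators
  corresponds to the inverse permutation of the indices.\<close>

lemma permute_vec_compose:
  assumes "\<tau> permutes {..<n}"
  shows "permute_vec n \<tau> (permute_vec n \<tau>' x) = permute_vec n (\<tau>' \<circ> \<tau>) x"
  by (intro eq_vecI) (simp_all add: permute_vec_def permutes_lessThan_iff[OF assms])

lemma permute_vec_id: "x \<in> carrier_vec n \<Longrightarrow> permute_vec n id x = x"
  by (auto simp: permute_vec_def)

lemma permutesI_inverse:
  assumes "\<And>x. p (q x) = x" "\<And>x. q (p x) = x" "\<And>x. x \<notin> S \<Longrightarrow> p x = x"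
  shows "p permutes S"
  unfolding permutes_def using assms by metis

lemma permutes_shift_down:
  assumes "\<pi> permutes {1..n}"
  shows "(\<lambda>i. \<pi> (Suc i) - 1) permutes {..<n}"
proof (rule permutesI_inverse[where q = "\<lambda>i. inv_into UNIV \<pi> (Suc i) - 1"])
  have inv: "inv_into UNIV \<pi> permutes {1..n}" using permutes_inv[OF assms] .
  \<comment> \<open>Positivity keeps the truncated subtraction in the index shift exact.\<close>
  have pos: "0 < p (Suc i)" if "p permutes {1..n}" for p i
    using permutes_not_in[OF that, of "Suc i"] permutes_in_image[OF that, of "Suc i"]
    by (cases "Suc i \<in> {1..n}") auto
  show "\<pi> (Suc (inv_into UNIV \<pi> (Suc i) - 1)) - 1 = i" for i
    using pos[OF inv, of i] permutes_inverses[OF assms] by simp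
  show "inv_into UNIV \<pi> (Suc (\<pi> (Suc i) - 1)) - 1 = i" for i
    using pos[OF assms, of i] permutes_inverses[OF assms] by simp
  show "\<pi> (Suc i) - 1 = i" if "i \<notin> {..<n}" for i
    using permutes_not_in[OF assms, of "Suc i"] that by simp
qed

text \<open>The point 0 must be fixed separately: as \<open>0 - 1 = 0\<close> for natural numbers,
  the general formula would send it to \<open>Suc (\<tau> 0)\<close>.\<close>

lemma permutes_shift_up:
  assumes "\<tau> permutes {..<n}"
  shows "(\<lambda>j. if j = 0 then 0 else Suc (\<tau> (j - 1))) permutes {1..n}"
proof (rule permutesI_inverse[where q = "\<lambda>j. if j = 0 then 0 else Suc (inv_into UNIV \<tau> (j - 1))"])
  show "(if j = 0 then 0 else Suc (\<tau> (j - 1))) = j" if "j \<notin> {1..n}" for j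
    using permutes_not_in[OF assms, of "j - 1"] that by auto
qed (simp_all add: permutes_inverses[OF assms])

lemma red_permute_vec:
  assumes "\<pi> permutes {1..n}"
  shows "red n (permute_vec n (\<lambda>i. \<pi> (Suc i) - 1) x) = (\<lambda>j\<in>{1..n}. red n x (\<pi> j))"
proof (rule ext)
  fix j
  show "red n (permute_vec n (\<lambda>i. \<pi> (Suc i) - 1) x) j = (\<lambda>j\<in>{1..n}. red n x (\<pi> j)) j"
    using permutes_in_image[OF assms, of j]
    by (cases "j \<in> {1..n}") (auto simp: red_def permute_vec_def)
qed

text \<open>Both sides are additive in \<open>x\<close>, so it suffices to compare them on
  generators. Since \<open>h\<close> moves generator \<open>i\<close> to \<open>\<sigma> i\<close>,
  coordinate \<open>j\<close> of the result is read off at the preimage of \<open>j\<close> under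
  \<open>\<sigma>\<close>.\<close>

lemma hom_Z2_pow_eq_permutation:
  assumes h: "h \<in> hom (Z2_pow n) (Z2_pow n)" and \<sigma>: "\<sigma> permutes {1..n}"
    and gen: "\<forall>i\<in>{1..n}. h (t_gen n i) = t_gen n (\<sigma> i)" and x: "x \<in> carrier_vec n"
  shows "h (red n x) = red n (permute_vec n (\<lambda>i. inv_into UNIV \<sigma> (Suc i) - 1) x)"
proof -
  have \<pi>: "inv_into UNIV \<sigma> permutes {1..n}" using permutes_inv[OF \<sigma>] .
  interpret group_hom "Z2_pow n" "Z2_pow n" h
    by (simp add: group_hom_def group_hom_axioms_def group_Z2_pow h)
  have in_I: "inv_into UNIV \<sigma> j \<in> {1..n} \<longleftrightarrow> j \<in> {1..n}" for j using permutes_in_image[OF \<pi>] .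
  have "h (red n x) = (\<lambda>j\<in>{1..n}. red n x (inv_into UNIV \<sigma> j))"
    using x
  proof (rule int_vec_closed_induct[of n, rotated -1])
    fix x y :: "int vec"
    assume xy: "x \<in> carrier_vec n" "y \<in> carrier_vec n"
      "h (red n x) = (\<lambda>j\<in>{1..n}. red n x (inv_into UNIV \<sigma> j))"
      "h (red n y) = (\<lambda>j\<in>{1..n}. red n y (inv_into UNIV \<sigma> j))"
    show "h (red n (x - y)) = (\<lambda>j\<in>{1..n}. red n (x - y) (inv_into UNIV \<sigma> j))"
      unfolding red_diff[OF xy(1,2)] hom_mult[OF red_in_carrier red_in_carrier] xy(3,4)
      unfolding mult_Z2_pow
      by (rule restrict_ext) (simp add: in_I del: atLeastAtMost_iff One_nat_def)
  next
    show "h (red n (0\<^sub>v n)) = (\<lambda>j\<in>{1..n}. red n (0\<^sub>v n) (inv_into UNIV \<sigma> j))"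
      unfolding red_zero hom_one unfolding one_Z2_pow
      by (rule restrict_ext) (simp add: in_I del: atLeastAtMost_iff One_nat_def)
  next
    fix i assume i: "i < n"
    have "inv_into UNIV \<sigma> j = Suc i \<longleftrightarrow> j = \<sigma> (Suc i)" for j
      using permutes_inverses[OF \<sigma>] by metis
    then show "h (red n (unit_vec n i)) = (\<lambda>j\<in>{1..n}. red n (unit_vec n i) (inv_into UNIV \<sigma> j))"
      using in_I i gen by (simp add: red_unit_vec) (auto simp: t_gen_def)
  qed
  then show ?thesis by (simp only: red_permute_vec[OF \<pi>])
qed

text \<open>The map \<open>h\<close> is determined by \<open>\<sigma>\<close>, and
  \<open>\<tau>\<close> is the inverse of \<open>\<sigma>\<close> shifted to indices from 0. In this
  form the equivalence says that a coordinate permutation carries the preimage lattice of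
  \<open>W1\<close> onto that of \<open>W2\<close>.\<close>

lemma Sub_equiv_iff:
  assumes W1: "subgroup W1 (Z2_pow n)" and W2: "subgroup W2 (Z2_pow n)"
  shows "(W1, W2) \<in> Sub_equiv n \<longleftrightarrow>
    (\<exists>\<tau>. \<tau> permutes {..<n} \<and>
       (\<forall>x\<in>carrier_vec n. red n x \<in> W1 \<longleftrightarrow> red n (permute_vec n \<tau> x) \<in> W2))"
proof
  assume "(W1, W2) \<in> Sub_equiv n"
  then obtain \<sigma> h where \<sigma>: "\<sigma> permutes {1..n}" and h: "h \<in> hom (Z2_pow n) (Z2_pow n)"
    and gen: "\<forall>i\<in>{1..n}. h (t_gen n i) = t_gen n (\<sigma> i)"
    and iso: "h \<in> iso ((Z2_pow n)\<lparr>carrier := W1\<rparr>) ((Z2_pow n)\<lparr>carrier := W2\<rparr>)"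
    by (auto simp: Sub_equiv_def)
  have \<pi>: "inv_into UNIV \<sigma> permutes {1..n}" using permutes_inv[OF \<sigma>] .
  define \<tau> where "\<tau> = (\<lambda>i. inv_into UNIV \<sigma> (Suc i) - 1)"
  have \<tau>: "\<tau> permutes {..<n}" unfolding \<tau>_def by (rule permutes_shift_down[OF \<pi>])
  have h_red: "h (red n x) = red n (permute_vec n \<tau> x)" if "x \<in> carrier_vec n" for x
    unfolding \<tau>_def by (rule hom_Z2_pow_eq_permutation[OF h \<sigma> gen that])
  have img: "h ` W1 = W2" using iso by (auto simp: iso_def bij_betw_def)
  \<comment> \<open>This identifies \<open>red n x\<close> with the element of \<open>W1\<close>
    that \<open>h\<close> maps to the same place.\<close>
  have inj: "red n x = red n y" if "red n (permute_vec n \<tau> x) = red n (permute_vec n \<tau> y)" for x y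
  proof -
    have "x $ i mod 2 = y $ i mod 2" if "i < n" for i
    proof -
      have "inv_into UNIV \<tau> i < n" using permutes_lessThan_iff[OF permutes_inv[OF \<tau>]] that by simp
      moreover have "\<tau> (inv_into UNIV \<tau> i) = i" by (rule permutes_inverses(1)[OF \<tau>])
      ultimately show ?thesis
        using \<open>red n (permute_vec n \<tau> x) = red n (permute_vec n \<tau> y)\<close>
        by (auto simp: red_eq_iff permute_vec_def)
    qed
    then show ?thesis by (simp add: red_eq_iff)
  qed
  have "red n x \<in> W1 \<longleftrightarrow> red n (permute_vec n \<tau> x) \<in> W2" if x: "x \<in> carrier_vec n" for x
  proof
    assume "red n x \<in> W1"
    then show "red n (permute_vec n \<tau> x) \<in> W2" using img by (simp flip: h_red[OF x]) blast
  next
    assume "red n (permute_vec n \<tau> x) \<in> W2"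
    then obtain w where w: "w \<in> W1" "h w = red n (permute_vec n \<tau> x)" using img by force
    obtain y where y: "y \<in> carrier_vec n" "red n y = w"
      using ex_red_eq subgroup.mem_carrier[OF W1 w(1)] by blast
    then have "red n x = w" using h_red[OF y(1)] w inj by metis
    then show "red n x \<in> W1" using w by simp
  qed
  with \<tau> show "\<exists>\<tau>. \<tau> permutes {..<n} \<and>
      (\<forall>x\<in>carrier_vec n. red n x \<in> W1 \<longleftrightarrow> red n (permute_vec n \<tau> x) \<in> W2)" by blast
next
  assume "\<exists>\<tau>. \<tau> permutes {..<n} \<and>
      (\<forall>x\<in>carrier_vec n. red n x \<in> W1 \<longleftrightarrow> red n (permute_vec n \<tau> x) \<in> W2)"
  then obtain \<tau> where \<tau>: "\<tau> permutes {..<n}"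
    and iff: "\<And>x. x \<in> carrier_vec n \<Longrightarrow> red n x \<in> W1 \<longleftrightarrow> red n (permute_vec n \<tau> x) \<in> W2" by blast
  define \<pi> where "\<pi> = (\<lambda>j. if j = 0 then 0 else Suc (\<tau> (j - 1)))"
  have \<pi>: "\<pi> permutes {1..n}" unfolding \<pi>_def by (rule permutes_shift_up[OF \<tau>])
  define \<sigma> where "\<sigma> = inv_into UNIV \<pi>"
  have \<sigma>: "\<sigma> permutes {1..n}" unfolding \<sigma>_def by (rule permutes_inv[OF \<pi>])
  have in_I: "\<pi> j \<in> {1..n} \<longleftrightarrow> j \<in> {1..n}" for j by (rule permutes_in_image[OF \<pi>])
  define h where "h f = (\<lambda>j\<in>{1..n}. f (\<pi> j))" for f :: "nat \<Rightarrow> int"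
  have h_red: "h (red n x) = red n (permute_vec n \<tau> x)" for x
  proof -
    have "\<tau> = (\<lambda>i. \<pi> (Suc i) - 1)" by (simp add: \<pi>_def)
    then show ?thesis by (simp only: h_def red_permute_vec[OF \<pi>])
  qed
  have h_carrier: "h f \<in> carrier (Z2_pow n)" if "f \<in> carrier (Z2_pow n)" for f
    unfolding h_def carrier_Z2_pow restrict_PiE_iff
  proof
    fix j assume "j \<in> {1..n}"
    then show "f (\<pi> j) \<in> {0, 1}" using PiE_mem that in_I unfolding carrier_Z2_pow by metis
  qed
  have h_mult: "h (f \<otimes>\<^bsub>Z2_pow n\<^esub> g) = h f \<otimes>\<^bsub>Z2_pow n\<^esub> h g" for f g
    unfolding h_def mult_Z2_pow
    by (rule restrict_ext) (simp add: in_I del: atLeastAtMost_iff One_nat_def)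
  have h_gen: "h (t_gen n i) = t_gen n (\<sigma> i)" if "i \<in> {1..n}" for i
  proof -
    have "\<pi> j = i \<longleftrightarrow> j = \<sigma> i" for j
      unfolding \<sigma>_def using permutes_inverses[OF \<pi>] by metis
    then show ?thesis using in_I by (auto simp: h_def t_gen_def)
  qed
  have "h ` W1 = W2"
  proof (intro subset_antisym image_subsetI subsetI)
    fix w assume w: "w \<in> W1"
    then obtain x where "x \<in> carrier_vec n" "red n x = w"
      using ex_red_eq subgroup.mem_carrier[OF W1 w] by blast
    then show "h w \<in> W2" using h_red iff w by metis
  next
    fix w assume w: "w \<in> W2"
    then obtain y where y: "y \<in> carrier_vec n" "red n y = w"
      using ex_red_eq subgroup.mem_carrier[OF W2 w] by blast
    let ?x = "permute_vec n (inv_into UNIV \<tau>) y"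
    have "permute_vec n \<tau> ?x = y"
      using y \<tau> by (simp add: permute_vec_compose permutes_inv_o permute_vec_id)
    then show "w \<in> h ` W1"
      using y w iff[of ?x] h_red[of ?x] by (intro image_eqI[of _ _ "red n ?x"]) auto
  qed
  moreover have "inj_on h W1"
  proof (rule inj_onI)
    fix f g assume fg: "f \<in> W1" "g \<in> W1" "h f = h g"
    have "f j = g j" if "j \<in> {1..n}" for j
    proof -
      have "\<sigma> j \<in> {1..n}" "\<pi> (\<sigma> j) = j"
        using permutes_in_image[OF \<sigma>] that permutes_inverses[OF \<pi>] by (auto simp: \<sigma>_def)
      then show ?thesis using fun_cong[OF fg(3), of "\<sigma> j"] by (simp add: h_def)
    qed
    moreover have "f \<in> carrier (Z2_pow n)" "g \<in> carrier (Z2_pow n)"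
      using fg subgroup.mem_carrier[OF W1] by auto
    ultimately show "f = g"
      unfolding carrier_Z2_pow by (meson PiE_ext)
  qed
  ultimately have "h \<in> iso ((Z2_pow n)\<lparr>carrier := W1\<rparr>) ((Z2_pow n)\<lparr>carrier := W2\<rparr>)"
    using h_mult by (auto simp: iso_def hom_def bij_betw_def)
  moreover have "h \<in> hom (Z2_pow n) (Z2_pow n)"
    using h_mult h_carrier by (auto simp: hom_def)
  ultimately show "(W1, W2) \<in> Sub_equiv n"
    unfolding Sub_equiv_def using W1 W2 \<sigma> h_gen by blast
qed

lemma equiv_Sub_equiv: "equiv {W. subgroup W (Z2_pow n)} (Sub_equiv n)"
proof (rule equivI)
  show sub: "Sub_equiv n \<subseteq> {W. subgroup W (Z2_pow n)} \<times> {W. subgroup W (Z2_pow n)}"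
    by (auto simp: Sub_equiv_def)
  show "refl_on {W. subgroup W (Z2_pow n)} (Sub_equiv n)"
    by (auto intro!: refl_onI exI[of _ id] simp: Sub_equiv_iff permute_vec_id permutes_id)
  show "sym (Sub_equiv n)"
  proof (rule symI)
    fix V W assume VW: "(V, W) \<in> Sub_equiv n"
    then have sgr: "subgroup V (Z2_pow n)" "subgroup W (Z2_pow n)" using sub by auto
    then obtain \<tau> where \<tau>: "\<tau> permutes {..<n}"
      and iff: "\<And>x. x \<in> carrier_vec n \<Longrightarrow> red n x \<in> V \<longleftrightarrow> red n (permute_vec n \<tau> x) \<in> W"
      using VW by (auto simp: Sub_equiv_iff)
    have "red n x \<in> W \<longleftrightarrow> red n (permute_vec n (inv_into UNIV \<tau>) x) \<in> V" if "x \<in> carrier_vec n" for x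
      using iff[of "permute_vec n (inv_into UNIV \<tau>) x"] \<tau> that
      by (simp add: permute_vec_compose permutes_inv_o permute_vec_id)
    then show "(W, V) \<in> Sub_equiv n"
      using sgr permutes_inv[OF \<tau>] by (auto simp: Sub_equiv_iff)
  qed
  show "trans (Sub_equiv n)"
  proof (rule transI)
    fix U V W assume UVW: "(U, V) \<in> Sub_equiv n" "(V, W) \<in> Sub_equiv n"
    then have sgr: "subgroup U (Z2_pow n)" "subgroup V (Z2_pow n)" "subgroup W (Z2_pow n)"
      using sub by auto
    then obtain \<tau> \<tau>' where \<tau>: "\<tau> permutes {..<n}" "\<tau>' permutes {..<n}"
      and iff: "\<And>x. x \<in> carrier_vec n \<Longrightarrow> red n x \<in> U \<longleftrightarrow> red n (permute_vec n \<tau> x) \<in> V"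
        "\<And>x. x \<in> carrier_vec n \<Longrightarrow> red n x \<in> V \<longleftrightarrow> red n (permute_vec n \<tau>' x) \<in> W"
      using UVW by (auto simp: Sub_equiv_iff)
    then have "\<forall>x\<in>carrier_vec n. red n x \<in> U \<longleftrightarrow> red n (permute_vec n (\<tau> \<circ> \<tau>') x) \<in> W"
      by (simp add: permute_vec_compose)
    moreover have "\<tau> \<circ> \<tau>' permutes {..<n}" using \<tau> by (simp add: permutes_compose)
    ultimately show "(U, W) \<in> Sub_equiv n"
      using sgr by (auto simp: Sub_equiv_iff)
  qed
qed

subsection \<open>General linear groups and sign matrices\<close>

lemma carrier_GL:
  "A \<in> carrier (GL TYPE('a::comm_ring_1) n) \<longleftrightarrow>
     A \<in> carrier_mat n n \<and> (\<exists>B\<in>carrier_mat n n. A * B = 1\<^sub>m n \<and> B * A = 1\<^sub>m n)"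
  by (auto simp: GL_def units_of_def Units_def ring_mat_simps)

lemma mult_GL: "A \<otimes>\<^bsub>GL TYPE('a::comm_ring_1) n\<^esub> B = A * B"
  by (simp add: GL_def units_of_def ring_mat_simps)

lemma one_GL: "\<one>\<^bsub>GL TYPE('a::comm_ring_1) n\<^esub> = 1\<^sub>m n"
  by (simp add: GL_def units_of_def ring_mat_simps)

lemma group_GL: "group (GL TYPE('a::comm_ring_1) n)"
  unfolding GL_def by (rule monoid.units_group[OF ring.is_monoid[OF ring_mat]])

lemma GL_carrier_mat: "A \<in> carrier (GL TYPE('a::comm_ring_1) n) \<Longrightarrow> A \<in> carrier_mat n n"
  by (simp add: carrier_GL)

lemma GL_inv:
  assumes "A \<in> carrier (GL TYPE('a::comm_ring_1) n)"
  shows "inv\<^bsub>GL TYPE('a) n\<^esub> A \<in> carrier_mat n n"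
    "A * inv\<^bsub>GL TYPE('a) n\<^esub> A = 1\<^sub>m n" "inv\<^bsub>GL TYPE('a) n\<^esub> A * A = 1\<^sub>m n"
  using group.inv_closed[OF group_GL assms] group.r_inv[OF group_GL assms]
    group.l_inv[OF group_GL assms] by (auto simp: mult_GL one_GL GL_carrier_mat)

text \<open>The group \<open>D\<close> of the overview. By \<open>diag_rep_image\<close> it is the
  image of every diagonal representation, so only this set matters and not how the representation
  parametrises it.\<close>

definition sign_mats :: "nat \<Rightarrow> int mat set" where
  "sign_mats n = {mat_diag n s | s. (\<forall>i<n. s i = 1 \<or> s i = -1) \<and> (\<Prod>i<n. s i) = 1}"

lemma det_mat_diag: "det (mat_diag n s) = (\<Prod>i<n. s i)" for s :: "nat \<Rightarrow> 'a::idom"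
proof -
  have "upper_triangular (mat_diag n s)" by (auto simp: mat_diag_def)
  then have "det (mat_diag n s) = prod_list (diag_mat (mat_diag n s))"
    by (rule det_upper_triangular[OF _ mat_diag_dim])
  also have "\<dots> = (\<Prod>i<n. s i)"
    by (simp add: diag_mat_def mat_diag_def atLeast0LessThan flip: prod.distinct_set_conv_list)
  finally show ?thesis .
qed

lemma mat_diag_cong: "(\<And>i. i < n \<Longrightarrow> s i = s' i) \<Longrightarrow> mat_diag n s = mat_diag n s'"
  by (auto simp: mat_diag_def)

lemma sign_mats_carrier: "d \<in> sign_mats n \<Longrightarrow> d \<in> carrier_mat n n"
  by (auto simp: sign_mats_def)

lemma sign_mats_square: "d \<in> sign_mats n \<Longrightarrow> d * d = 1\<^sub>m n"
proof -
  assume "d \<in> sign_mats n"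
  then obtain s where "d = mat_diag n s" "\<forall>i<n. s i = 1 \<or> s i = -1" by (auto simp: sign_mats_def)
  moreover from this have "mat_diag n (\<lambda>i. s i * s i) = mat_diag n (\<lambda>i. 1)"
    by (intro mat_diag_cong) auto
  ultimately show ?thesis by simp
qed

text \<open>The determinant fixes the last sign once the first \<open>n - 1\<close> are known, so
  restricting to these loses nothing.\<close>

lemma finite_sign_mats: "finite (sign_mats n)" and card_sign_mats_le: "card (sign_mats n) \<le> 2 ^ (n - 1)"
proof -
  define F where "F A = (\<lambda>i\<in>{..<n - 1}. A $$ (i, i))" for A :: "int mat"
  have "inj_on F (sign_mats n)"
  proof (rule inj_onI)
    fix A B assume "A \<in> sign_mats n" "B \<in> sign_mats n" and F: "F A = F B"
    then obtain s s' where s: "A = mat_diag n s" "\<forall>i<n. s i = 1 \<or> s i = -1" "(\<Prod>i<n. s i) = 1"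
      and s': "B = mat_diag n s'" "\<forall>i<n. s' i = 1 \<or> s' i = -1" "(\<Prod>i<n. s' i) = 1"
      by (auto simp: sign_mats_def)
    have eq: "s i = s' i" if "i < n - 1" for i
      using fun_cong[OF F, of i] that s s' by (simp add: F_def mat_diag_def)
    have "s i = s' i" if "i < n" for i
    proof -
      obtain m where m: "n = Suc m" using \<open>i < n\<close> by (cases n) auto
      have "(\<Prod>i<m. s i) = (\<Prod>i<m. s' i)" using eq m by (intro prod.cong) auto
      then have "s m = s' m" using s(3) s'(3) m by (auto simp: zmult_eq_1_iff)
      with eq that m show ?thesis by (cases "i = m") auto
    qed
    then show "A = B" using s s' by (auto intro: mat_diag_cong)
  qed
  moreover have "F ` sign_mats n \<subseteq> ({..<n - 1} \<rightarrow>\<^sub>E {1, -1})"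
  proof (rule image_subsetI)
    fix A assume "A \<in> sign_mats n"
    then obtain s where s: "A = mat_diag n s" "\<forall>i<n. s i = 1 \<or> s i = -1"
      by (auto simp: sign_mats_def)
    show "F A \<in> {..<n - 1} \<rightarrow>\<^sub>E {1, -1}"
      unfolding F_def restrict_PiE_iff using s by (auto simp: mat_diag_def)
  qed
  moreover have "finite ({..<n - 1} \<rightarrow>\<^sub>E {1, -1 :: int})" by (simp add: finite_PiE)
  moreover have "card ({..<n - 1} \<rightarrow>\<^sub>E {1, -1 :: int}) = 2 ^ (n - 1)"
    by (simp add: card_PiE flip: numeral_2_eq_2)
  ultimately show "finite (sign_mats n)" "card (sign_mats n) \<le> 2 ^ (n - 1)"
    using inj_on_finite card_inj_on_le by (fastforce, metis)
qed

text \<open>One inclusion holds because a diagonal involution over the integers has entries 1 and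
  -1; equality follows by counting, as injectivity gives the image \<open>2 ^ (n - 1)\<close>
  elements.\<close>

lemma diag_rep_image:
  assumes "is_diag_rep n \<rho>"
  shows "\<rho> ` carrier (Z2_pow (n - 1)) = sign_mats n"
proof (rule card_seteq[OF finite_sign_mats])
  let ?Z = "Z2_pow (n - 1)"
  have hom: "\<rho> \<in> hom ?Z (SL TYPE(int) n)" and inj: "inj_on \<rho> (carrier ?Z)"
    and diag: "\<And>g. g \<in> carrier ?Z \<Longrightarrow> diagonal_mat (\<rho> g)"
    using assms by (auto simp: is_diag_rep_def)
  have mult: "\<rho> (f \<otimes>\<^bsub>?Z\<^esub> g) = \<rho> f * \<rho> g" if "f \<in> carrier ?Z" "g \<in> carrier ?Z" for f g
    using hom_mult[OF hom that] by (simp add: SL_def mult_GL)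
  have GL: "\<rho> g \<in> carrier (GL TYPE(int) n)" "det (\<rho> g) = 1" if "g \<in> carrier ?Z" for g
    using hom_in_carrier[OF hom that] by (auto simp: SL_def)
  \<comment> \<open>The image of the identity is idempotent, and the only idempotent of the group
    \<open>GL\<close> is its identity.\<close>
  have one: "\<rho> \<one>\<^bsub>?Z\<^esub> = 1\<^sub>m n"
  proof -
    have "\<one>\<^bsub>?Z\<^esub> \<in> carrier ?Z" by (simp add: group.is_monoid group_Z2_pow)
    moreover from this have "\<rho> \<one>\<^bsub>?Z\<^esub> * \<rho> \<one>\<^bsub>?Z\<^esub> = \<rho> \<one>\<^bsub>?Z\<^esub>"
      using mult[of "\<one>\<^bsub>?Z\<^esub>" "\<one>\<^bsub>?Z\<^esub>"] by (simp add: Z2_pow_square)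
    ultimately show ?thesis
      using group.l_cancel_one[OF group_GL, of "\<rho> \<one>\<^bsub>?Z\<^esub>" n "\<rho> \<one>\<^bsub>?Z\<^esub>"] GL
      by (simp add: mult_GL one_GL)
  qed
  show "\<rho> ` carrier ?Z \<subseteq> sign_mats n"
  proof (rule image_subsetI)
    fix g assume g: "g \<in> carrier ?Z"
    define s where "s i = \<rho> g $$ (i, i)" for i
    have c: "\<rho> g \<in> carrier_mat n n" using GL[OF g] by (simp add: carrier_GL)
    then have \<rho>g: "\<rho> g = mat_diag n s"
      using diag[OF g] by (intro eq_matI) (auto simp: mat_diag_def s_def diagonal_mat_def)
    have "\<rho> g * \<rho> g = 1\<^sub>m n" using mult[OF g g] one g by (simp add: Z2_pow_square)
    then have one: "mat_diag n (\<lambda>i. s i * s i) = 1\<^sub>m n" by (simp add: \<rho>g)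
    then have sq: "s i * s i = 1" if "i < n" for i
      using that one[unfolded mat_diag_def, THEN arg_cong, of "\<lambda>A. A $$ (i, i)"]
      by (simp del: mat_diag_one)
    have "s i = 1 \<or> s i = -1" if "i < n" for i
      using sq[OF that] by (auto simp: zmult_eq_1_iff)
    moreover have "(\<Prod>i<n. s i) = 1" using GL(2)[OF g] by (simp add: \<rho>g det_mat_diag)
    ultimately show "\<rho> g \<in> sign_mats n" unfolding sign_mats_def using \<rho>g by blast
  qed
  have "card (carrier ?Z) = 2 ^ (n - 1)"
    by (simp add: carrier_Z2_pow card_PiE flip: numeral_2_eq_2)
  then show "card (sign_mats n) \<le> card (\<rho> ` carrier ?Z)"
    using card_sign_mats_le[of n] by (simp only: card_image[OF inj])
qed

subsection \<open>Lattices between \<open>2 \<int>\<^sup>n\<close> and \<open>\<int>\<^sup>n\<close>\<close>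

text \<open>The columns of \<open>B\<close> are a basis of the preimage of \<open>W\<close> in
  \<open>\<int>\<^sup>n\<close>. Their independence is a consequence of spanning: for a subgroup
  \<open>W\<close> the preimage contains \<open>2 \<int>\<^sup>n\<close> and thus has rank
  \<open>n\<close>.\<close>

definition lattice_basis :: "nat \<Rightarrow> (nat \<Rightarrow> int) set \<Rightarrow> int mat \<Rightarrow> bool" where
  "lattice_basis n W B \<longleftrightarrow> B \<in> carrier_mat n n \<and>
     (\<forall>x\<in>carrier_vec n. red n x \<in> W \<longleftrightarrow> (\<exists>c\<in>carrier_vec n. x = B *\<^sub>v c))"

text \<open>For nonsingular \<open>B\<close>, this is the intersection of \<open>B\<^sup>-\<^sup>1 D B\<close> with \<open>GL(n, \<int>)\<close>, where \<open>D\<close> is the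
  group of sign matrices; it is written without \<open>B\<^sup>-\<^sup>1\<close>, which need not be integral.\<close>

definition integral_conj :: "nat \<Rightarrow> int mat \<Rightarrow> int mat set" where
  "integral_conj n B = {A \<in> carrier (GL TYPE(int) n). \<exists>d\<in>sign_mats n. B * A = d * B}"

lemma mult_mat_unit_vec:
  fixes A :: "'a::semiring_1 mat"
  assumes "A \<in> carrier_mat n m" "j < m"
  shows "A *\<^sub>v unit_vec m j = col A j"
  using assms by (intro eq_vecI) auto

lemma mat_diag_mult_vec:
  fixes x :: "'a::comm_semiring_1 vec"
  assumes "x \<in> carrier_vec n"
  shows "mat_diag n s *\<^sub>v x = vec n (\<lambda>i. s i * x $ i)"
proof (rule eq_vecI)
  fix i assume "i < dim_vec (vec n (\<lambda>i. s i * x $ i))"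
  then have i: "i < n" by simp
  have "row (mat_diag n s) i = s i \<cdot>\<^sub>v unit_vec n i"
    using i by (auto simp: mat_diag_def)
  then show "(mat_diag n s *\<^sub>v x) $ i = vec n (\<lambda>i. s i * x $ i) $ i"
    using i assms by (simp add: mat_diag_def)
qed (simp add: mat_diag_def)

lemma red_eq_one_iff: "red n x = \<one>\<^bsub>Z2_pow n\<^esub> \<longleftrightarrow> (\<forall>i<n. even (x $ i))"
  unfolding red_zero[symmetric] red_eq_iff by (auto simp: even_iff_mod_2_eq_zero)

text \<open>Signs vanish modulo 2. This is why every lattice that is a preimage under
  \<open>red n\<close> is invariant under \<open>D\<close>.\<close>

lemma red_sign_mat:
  assumes "d \<in> sign_mats n" "x \<in> carrier_vec n"
  shows "red n (d *\<^sub>v x) = red n x"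
proof -
  obtain s where s: "d = mat_diag n s" "\<forall>i<n. s i = 1 \<or> s i = -1"
    using assms by (auto simp: sign_mats_def)
  have "(s i * x $ i) mod 2 = x $ i mod 2" if "i < n" for i
  proof -
    have "(- a) mod 2 = a mod 2" for a :: int by presburger
    then show ?thesis using s(2) that by fastforce
  qed
  then show ?thesis using assms by (simp add: s(1) mat_diag_mult_vec red_eq_iff)
qed

lemma ex_lattice_basis:
  assumes W: "subgroup W (Z2_pow n)" shows "\<exists>B. lattice_basis n W B"
proof -
  have one: "\<one>\<^bsub>Z2_pow n\<^esub> \<in> W" by (rule subgroup.one_closed[OF W])
  define M where "M = {x \<in> carrier_vec n. red n x \<in> W}"
  have "\<exists>B\<in>carrier_mat n n. M = (\<lambda>c. B *\<^sub>v c) ` carrier_vec n"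
  proof (rule full_rank_lattice_basis[where m = 2])
    show "x - y \<in> M" if "x \<in> M" "y \<in> M" for x y
      using that red_in_subgroup_diff[OF W] by (auto simp: M_def)
    show "2 \<cdot>\<^sub>v unit_vec n i \<in> M" if "i < n" for i
    proof -
      have "red n (2 \<cdot>\<^sub>v unit_vec n i) = \<one>\<^bsub>Z2_pow n\<^esub>" by (simp add: red_eq_one_iff)
      then show ?thesis using one by (simp add: M_def)
    qed
  qed (use one in \<open>auto simp: M_def red_zero\<close>)
  then obtain B where "B \<in> carrier_mat n n" "M = (\<lambda>c. B *\<^sub>v c) ` carrier_vec n" by blast
  then have "lattice_basis n W B" unfolding lattice_basis_def M_def by blast
  then show ?thesis by blast
qed

text \<open>The source of the integral matrices below: lifts of sign matrices, base changes and the
  doubled inverse of \<open>B\<close> all arise as such quotients \<open>Y\<close>.\<close>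

lemma lattice_basis_factor:
  assumes B: "lattice_basis n W B" and X: "X \<in> carrier_mat n k"
    and cols: "\<And>j. j < k \<Longrightarrow> red n (col X j) \<in> W"
  shows "\<exists>Y\<in>carrier_mat n k. X = B * Y"
proof (rule eq_mult_mat_if_cols[OF _ X])
  fix j assume j: "j < k"
  then have "col X j \<in> carrier_vec n" using X by (intro col_carrier_vec)
  with cols[OF j] B show "\<exists>c\<in>carrier_vec n. col X j = B *\<^sub>v c"
    unfolding lattice_basis_def by blast
qed (use B in \<open>simp add: lattice_basis_def\<close>)

lemma lattice_basis_col:
  assumes B: "lattice_basis n W B" and "j < n"
  shows "red n (col B j) \<in> W"
proof -
  have "B \<in> carrier_mat n n" using B by (simp add: lattice_basis_def)
  then have "col B j = B *\<^sub>v unit_vec n j" "col B j \<in> carrier_vec n"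
    using mult_mat_unit_vec[of B n n j] \<open>j < n\<close> by (auto intro: col_carrier_vec)
  then show ?thesis
    using B unit_vec_carrier[of n j] unfolding lattice_basis_def by blast
qed

text \<open>Twice each unit vector lies in the lattice, so twice the identity matrix is divisible by
  \<open>B\<close>. The quotient \<open>C\<close> is twice the rational inverse of
  \<open>B\<close>.\<close>

lemma lattice_basis_half_inverse:
  assumes W: "subgroup W (Z2_pow n)" and B: "lattice_basis n W B"
  obtains C where "C \<in> carrier_mat n n" "B * C = 2 \<cdot>\<^sub>m 1\<^sub>m n" "C * B = 2 \<cdot>\<^sub>m 1\<^sub>m n"
    "det B \<noteq> 0"
proof -
  have Bc: "B \<in> carrier_mat n n" using B by (simp add: lattice_basis_def)
  have "\<exists>C\<in>carrier_mat n n. 2 \<cdot>\<^sub>m 1\<^sub>m n = B * C"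
  proof (rule lattice_basis_factor[OF B])
    fix j assume j: "j < n"
    have "red n (col (2 \<cdot>\<^sub>m 1\<^sub>m n) j) = \<one>\<^bsub>Z2_pow n\<^esub>"
      using j by (simp add: red_eq_one_iff)
    then show "red n (col (2 \<cdot>\<^sub>m 1\<^sub>m n) j) \<in> W" by (simp add: subgroup.one_closed[OF W])
  qed simp
  then obtain C where C: "C \<in> carrier_mat n n" "B * C = 2 \<cdot>\<^sub>m 1\<^sub>m n" by metis
  moreover have "C * B = 2 \<cdot>\<^sub>m 1\<^sub>m n" by (rule mult_eq_smult_one_commute[OF Bc C]) simp
  moreover have "det B \<noteq> 0" by (rule det_nonzero_if_mult_eq_smult_one[OF Bc C]) simp
  ultimately show ?thesis by (rule that)
qed

text \<open>Invariance of the lattice under \<open>d\<close> makes \<open>d * B\<close> divisible by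
  \<open>B\<close>. The quotient \<open>A\<close> inherits \<open>A * A = 1\<^sub>m n\<close> from
  \<open>d\<close> and is therefore its own integral inverse.\<close>

lemma sign_mat_lift:
  assumes W: "subgroup W (Z2_pow n)" and B: "lattice_basis n W B" and d: "d \<in> sign_mats n"
  shows "\<exists>A\<in>carrier (GL TYPE(int) n). B * A = d * B"
proof -
  have Bc: "B \<in> carrier_mat n n" using B by (simp add: lattice_basis_def)
  have dc: "d \<in> carrier_mat n n" by (rule sign_mats_carrier[OF d])
  have "\<exists>A\<in>carrier_mat n n. d * B = B * A"
  proof (rule lattice_basis_factor[OF B])
    fix j assume j: "j < n"
    have "red n (col (d * B) j) = red n (d *\<^sub>v col B j)"
      using Bc dc j by (simp add: col_mult2)
    also have "\<dots> = red n (col B j)"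
      using Bc j by (intro red_sign_mat[OF d] col_carrier_vec)
    finally show "red n (col (d * B) j) \<in> W" using lattice_basis_col[OF B j] by simp
  qed (use Bc dc in auto)
  then obtain A where A: "A \<in> carrier_mat n n" "d * B = B * A" by blast
  have "B * (A * A) = B * A * A" using A(1) Bc by simp
  also have "\<dots> = d * B * A" by (simp only: A(2))
  also have "\<dots> = d * (B * A)" by (rule assoc_mult_mat[OF dc Bc A(1)])
  also have "\<dots> = d * d * B" unfolding A(2)[symmetric] using Bc dc by simp
  also have "\<dots> = B * 1\<^sub>m n" using Bc by (simp add: sign_mats_square[OF d])
  finally have eq: "B * (A * A) = B * 1\<^sub>m n" .
  have "A * A = 1\<^sub>m n"
    by (rule mult_mat_left_cancel[OF Bc _ _ _ eq])
      (use A(1) in \<open>auto intro: lattice_basis_half_inverse[OF W B]\<close>)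
  then have "A \<in> carrier (GL TYPE(int) n)" using A by (auto simp: carrier_GL)
  with A show ?thesis by metis
qed

lemma carrier_GL_if_det_nonzero:
  fixes A :: "'a::field mat"
  assumes A: "A \<in> carrier_mat n n" and "det A \<noteq> 0"
  shows "A \<in> carrier (GL TYPE('a) n)"
proof -
  let ?B = "inverse (det A) \<cdot>\<^sub>m adj_mat A"
  have "A * ?B = 1\<^sub>m n" "?B * A = 1\<^sub>m n"
    using adj_mat[OF A] A \<open>det A \<noteq> 0\<close>
    by (auto simp: mult_smult_distrib[of _ n n _ n] mult_smult_assoc_mat[of _ n n _ n])
  then show ?thesis using A adj_mat(1)[OF A] by (auto simp: carrier_GL intro!: bexI[of _ ?B])
qed

lemma rationally_equivalent_if_intertwines:
  assumes B: "B \<in> carrier_mat n n" "det B \<noteq> 0"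
    and \<rho>: "\<And>g. g \<in> carrier G \<Longrightarrow> \<rho> g \<in> carrier_mat n n \<and> \<rho>' g \<in> carrier_mat n n \<and> B * \<rho> g = \<rho>' g * B"
  shows "rationally_equivalent n G \<rho> \<rho>'"
proof -
  let ?i = "map_mat (rat_of_int)"
  let ?P = "?i B"
  have Pc: "?P \<in> carrier_mat n n" using B by simp
  have P: "?P \<in> carrier (GL TYPE(rat) n)"
    using B by (intro carrier_GL_if_det_nonzero) (auto simp: of_int_hom.hom_det)
  note inv = GL_inv[OF P]
  have "?i (\<rho>' g) = ?P * ?i (\<rho> g) * inv\<^bsub>GL TYPE(rat) n\<^esub> ?P" if "g \<in> carrier G" for g
  proof -
    have g: "\<rho> g \<in> carrier_mat n n" "\<rho>' g \<in> carrier_mat n n" "B * \<rho> g = \<rho>' g * B"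
      using \<rho>[OF that] by auto
    have "?P * ?i (\<rho> g) = ?i (\<rho>' g) * ?P"
      using g B by (simp flip: of_int_hom.mat_hom_mult[of _ n n])
    then have "?P * ?i (\<rho> g) * inv\<^bsub>GL TYPE(rat) n\<^esub> ?P = ?i (\<rho>' g) * (?P * inv\<^bsub>GL TYPE(rat) n\<^esub> ?P)"
      using g Pc inv(1) by simp
    then show ?thesis using g by (simp add: inv)
  qed
  then show ?thesis
    unfolding rationally_equivalent_def using P by (auto simp: mult_GL)
qed

text \<open>Each \<open>\<rho>\<^sub>d g\<close> lifts through \<open>B\<close>. Cancelling
  \<open>B\<close> makes the lift unique, which yields both multiplicativity of
  \<open>\<rho>\<close> and the description of its image.\<close>

lemma integral_conj_is_image:
  assumes W: "subgroup W (Z2_pow n)" and B: "lattice_basis n W B" and diag: "is_diag_rep n \<rho>\<^sub>d"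
  shows "\<exists>\<rho>. \<rho> \<in> hom (Z2_pow (n - 1)) (GL TYPE(int) n) \<and>
    rationally_equivalent n (Z2_pow (n - 1)) \<rho> \<rho>\<^sub>d \<and>
    integral_conj n B = \<rho> ` carrier (Z2_pow (n - 1))"
proof -
  let ?Z = "Z2_pow (n - 1)"
  have Bc: "B \<in> carrier_mat n n" using B by (simp add: lattice_basis_def)
  have det: "det B \<noteq> 0" by (rule lattice_basis_half_inverse[OF W B])
  have d: "\<rho>\<^sub>d g \<in> sign_mats n" if "g \<in> carrier ?Z" for g
    using diag_rep_image[OF diag] that by blast
  obtain \<rho> where \<rho>: "\<And>g. g \<in> carrier ?Z \<Longrightarrow> \<rho> g \<in> carrier (GL TYPE(int) n) \<and> B * \<rho> g = \<rho>\<^sub>d g * B"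
    using sign_mat_lift[OF W B d] by metis
  have c: "\<rho> g \<in> carrier_mat n n" "\<rho>\<^sub>d g \<in> carrier_mat n n" if "g \<in> carrier ?Z" for g
    using \<rho>[OF that] d[OF that] by (auto simp: carrier_GL sign_mats_carrier)
  have cancel: "X = Y" if "X \<in> carrier_mat n n" "Y \<in> carrier_mat n n" "B * X = B * Y" for X Y
    using mult_mat_left_cancel[OF Bc det] that by blast
  have "\<rho> \<in> hom ?Z (GL TYPE(int) n)"
  proof (rule homI)
    fix f g assume fg: "f \<in> carrier ?Z" "g \<in> carrier ?Z"
    then have fg': "f \<otimes>\<^bsub>?Z\<^esub> g \<in> carrier ?Z"
      using group_Z2_pow group.subgroup_self subgroup.m_closed by metis
    have \<rho>\<^sub>d: "\<rho>\<^sub>d \<in> hom ?Z (SL TYPE(int) n)" using diag by (simp add: is_diag_rep_def)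
    note cs = c[OF fg(1)] c[OF fg(2)] c(1)[OF fg'] Bc
    have "B * (\<rho> f * \<rho> g) = \<rho>\<^sub>d f * B * \<rho> g"
      using cs \<rho>[OF fg(1)] by (simp flip: assoc_mult_mat[of B n n _ n _ n])
    also have "\<dots> = \<rho>\<^sub>d f * (B * \<rho> g)" using cs by simp
    also have "\<dots> = \<rho>\<^sub>d f * \<rho>\<^sub>d g * B" using cs \<rho>[OF fg(2)] by simp
    also have "\<rho>\<^sub>d f * \<rho>\<^sub>d g = \<rho>\<^sub>d (f \<otimes>\<^bsub>?Z\<^esub> g)"
      using hom_mult[OF \<rho>\<^sub>d fg] by (simp add: SL_def mult_GL)
    also have "\<dots> * B = B * \<rho> (f \<otimes>\<^bsub>?Z\<^esub> g)" using \<rho>[OF fg'] by simp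
    finally have "\<rho> f * \<rho> g = \<rho> (f \<otimes>\<^bsub>?Z\<^esub> g)"
      by (rule cancel[rotated 2]) (use cs in auto)
    then show "\<rho> (f \<otimes>\<^bsub>?Z\<^esub> g) = \<rho> f \<otimes>\<^bsub>GL TYPE(int) n\<^esub> \<rho> g"
      by (simp add: mult_GL)
  qed (simp add: \<rho>)
  moreover have "rationally_equivalent n ?Z \<rho> \<rho>\<^sub>d"
    using c \<rho> by (intro rationally_equivalent_if_intertwines[OF Bc det]) auto
  moreover have "integral_conj n B = \<rho> ` carrier ?Z"
  proof (intro subset_antisym image_subsetI subsetI)
    fix A assume "A \<in> integral_conj n B"
    then obtain d where A: "A \<in> carrier_mat n n" "d \<in> sign_mats n" "B * A = d * B"
      by (auto simp: integral_conj_def carrier_GL)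
    moreover from this obtain g where g: "g \<in> carrier ?Z" "d = \<rho>\<^sub>d g"
      using diag_rep_image[OF diag] by blast
    ultimately have "A = \<rho> g" using cancel[of A "\<rho> g"] c \<rho> by simp
    then show "A \<in> \<rho> ` carrier ?Z" using g by blast
  next
    fix g assume "g \<in> carrier ?Z"
    then show "\<rho> g \<in> integral_conj n B" unfolding integral_conj_def using \<rho> d by blast
  qed
  ultimately show ?thesis by blast
qed

subsection \<open>Equivalent subgroups and conjugate images\<close>

lemma permutation_matrix_mult_vec:
  fixes x :: "int vec"
  assumes \<tau>: "\<tau> permutes {..<n}" and x: "x \<in> carrier_vec n"
  shows "mat n n (\<lambda>(i, j). of_bool (j = \<tau> i)) *\<^sub>v x = permute_vec n \<tau> x"
proof (rule eq_vecI)
  fix i assume "i < dim_vec (permute_vec n \<tau> x)"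
  then have i: "i < n" by (simp add: permute_vec_def)
  then have \<tau>i: "\<tau> i < n" by (simp add: permutes_lessThan_iff[OF \<tau>])
  have "row (mat n n (\<lambda>(i, j). of_bool (j = \<tau> i) :: int)) i = unit_vec n (\<tau> i)"
    using i by (auto simp: unit_vec_def)
  then show "(mat n n (\<lambda>(i, j). of_bool (j = \<tau> i)) *\<^sub>v x) $ i = permute_vec n \<tau> x $ i"
    using i x \<tau>i by (simp add: permute_vec_def del: row_mat)
qed (simp add: permute_vec_def)

lemma mat_eq_if_mult_vec_eq:
  fixes A B :: "'a::semiring_1 mat"
  assumes "A \<in> carrier_mat n m" "B \<in> carrier_mat n m"
    and "\<And>x. x \<in> carrier_vec m \<Longrightarrow> A *\<^sub>v x = B *\<^sub>v x"
  shows "A = B"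
proof (rule mat_col_eqI)
  fix j assume "j < dim_col B"
  then have "j < m" using assms by simp
  then show "col A j = col B j"
    using assms(3)[of "unit_vec m j"] mult_mat_unit_vec[OF assms(1)] mult_mat_unit_vec[OF assms(2)]
    by simp
qed (use assms in auto)

text \<open>Moving \<open>d\<close> across the permutation matrix reindexes its diagonal by
  \<open>\<tau>\<close>, and reindexing preserves the product of the signs.\<close>

lemma permutation_matrix_conj_sign_mat:
  assumes \<tau>: "\<tau> permutes {..<n}" and d: "d \<in> sign_mats n"
  shows "\<exists>d'\<in>sign_mats n. mat n n (\<lambda>(i, j). of_bool (j = \<tau> i)) * d =
    d' * mat n n (\<lambda>(i, j). of_bool (j = \<tau> i))"
proof -
  obtain s where s: "d = mat_diag n s" "\<forall>i<n. s i = 1 \<or> s i = -1" "(\<Prod>i<n. s i) = 1"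
    using d by (auto simp: sign_mats_def)
  have "(\<Prod>i<n. s (\<tau> i)) = (\<Prod>i<n. s i)"
    using prod.permute[OF \<tau>, of s] by (simp add: o_def)
  then have "mat_diag n (s \<circ> \<tau>) \<in> sign_mats n"
    unfolding sign_mats_def using s(2,3)
    by (intro CollectI exI[of _ "s \<circ> \<tau>"]) (simp add: permutes_lessThan_iff[OF \<tau>])
  moreover have "mat n n (\<lambda>(i, j). of_bool (j = \<tau> i)) * d =
      mat_diag n (s \<circ> \<tau>) * mat n n (\<lambda>(i, j). of_bool (j = \<tau> i))"
    unfolding s(1) mat_diag_mult_left[of "mat n n f" n n for f, OF mat_carrier]
      mat_diag_mult_right[of "mat n n f" n n for f, OF mat_carrier]
    by (rule eq_matI) auto
  ultimately show ?thesis by blast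
qed

text \<open>\<open>U\<close> is the matrix of \<open>S\<close> in the bases \<open>B\<close> and
  \<open>B'\<close>. If \<open>A\<close> expresses \<open>d\<close> in the basis \<open>B\<close>,
  then \<open>U * A * V\<close> expresses the \<open>S\<close>-conjugate \<open>d'\<close> of
  \<open>d\<close> in the basis \<open>B'\<close>.\<close>

lemma integral_conj_transport:
  assumes c: "S \<in> carrier_mat n n" "B \<in> carrier_mat n n" "B' \<in> carrier_mat n n" "V \<in> carrier_mat n n"
    and U: "U \<in> carrier (GL TYPE(int) n)" and V: "V = inv\<^bsub>GL TYPE(int) n\<^esub> U"
    and SB: "S * B = B' * U"
    and S: "\<And>d. d \<in> sign_mats n \<Longrightarrow> \<exists>d'\<in>sign_mats n. S * d = d' * S"
    and A: "A \<in> integral_conj n B"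
  shows "U * A * V \<in> integral_conj n B'"
proof -
  have Uc: "U \<in> carrier_mat n n" using U by (simp add: carrier_GL)
  have UV: "U * V = 1\<^sub>m n" using GL_inv[OF U] V by simp
  obtain d where A: "A \<in> carrier (GL TYPE(int) n)" "d \<in> sign_mats n" "B * A = d * B"
    using A by (auto simp: integral_conj_def)
  obtain d' where d': "d' \<in> sign_mats n" "S * d = d' * S" using S[OF A(2)] by blast
  note assoc = assoc_mult_mat[of _ n n _ n _ n] mult_carrier_mat[of _ n n _ n]
  note c = c Uc GL_carrier_mat[OF A(1)] sign_mats_carrier[OF A(2)] sign_mats_carrier[OF d'(1)]
  have "B' * (U * A * V) = B' * U * (A * V)" using c by (simp add: assoc)
  also have "\<dots> = S * (B * A) * V" unfolding SB[symmetric] using c by (simp add: assoc)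
  also have "\<dots> = S * d * (B * V)" unfolding A(3) using c by (simp add: assoc)
  also have "\<dots> = d' * (S * B) * V" unfolding d'(2) using c by (simp add: assoc)
  also have "\<dots> = d' * B' * (U * V)" unfolding SB using c by (simp add: assoc)
  finally have "B' * (U * A * V) = d' * B'" using c by (simp add: UV)
  moreover have "U * A * V \<in> carrier (GL TYPE(int) n)"
  proof -
    interpret group "GL TYPE(int) n" by (rule group_GL)
    have "U \<otimes>\<^bsub>GL TYPE(int) n\<^esub> A \<otimes>\<^bsub>GL TYPE(int) n\<^esub> V \<in> carrier (GL TYPE(int) n)"
      unfolding V using U A by blast
    then show ?thesis by (simp add: mult_GL)
  qed
  ultimately show ?thesis using d' by (auto simp: integral_conj_def)
qed

text \<open>A permutation matrix and its inverse carry the two lattices onto each other. Written in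
  the bases they become integral matrices \<open>U\<close> and \<open>V\<close> that are mutually
  inverse, and transport in both directions gives equality. The case \<open>W = W'\<close> shows
  that another basis yields a conjugate group.\<close>

lemma conj_if_Sub_equiv:
  assumes W: "subgroup W (Z2_pow n)" and W': "subgroup W' (Z2_pow n)"
    and B: "lattice_basis n W B" and B': "lattice_basis n W' B'"
    and equiv: "(W, W') \<in> Sub_equiv n"
  shows "\<exists>U\<in>carrier (GL TYPE(int) n).
    integral_conj n B' = (\<lambda>A. U * A * inv\<^bsub>GL TYPE(int) n\<^esub> U) ` integral_conj n B"
proof -
  obtain \<tau> where \<tau>: "\<tau> permutes {..<n}"
    and iff: "\<And>x. x \<in> carrier_vec n \<Longrightarrow> red n x \<in> W \<longleftrightarrow> red n (permute_vec n \<tau> x) \<in> W'"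
    using equiv by (auto simp: Sub_equiv_iff[OF W W'])
  define \<tau>' where "\<tau>' = inv_into UNIV \<tau>"
  have \<tau>': "\<tau>' permutes {..<n}" unfolding \<tau>'_def by (rule permutes_inv[OF \<tau>])
  have id: "permute_vec n \<tau> (permute_vec n \<tau>' x) = x" "permute_vec n \<tau>' (permute_vec n \<tau> x) = x"
    if "x \<in> carrier_vec n" for x :: "int vec"
    using that \<tau> \<tau>' by (simp_all add: permute_vec_compose permutes_inv_o permute_vec_id \<tau>'_def)
  define S where "S = mat n n (\<lambda>(i, j). of_bool (j = \<tau> i) :: int)"
  define S' where "S' = mat n n (\<lambda>(i, j). of_bool (j = \<tau>' i) :: int)"
  have Sv: "S *\<^sub>v x = permute_vec n \<tau> x" "S' *\<^sub>v x = permute_vec n \<tau>' x"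
    if "x \<in> carrier_vec n" for x
    unfolding S_def S'_def using permutation_matrix_mult_vec \<tau> \<tau>' that by blast+
  have Sc: "S \<in> carrier_mat n n" "S' \<in> carrier_mat n n" by (simp_all add: S_def S'_def)
  have SS': "S * S' = 1\<^sub>m n" "S' * S = 1\<^sub>m n"
    by (rule mat_eq_if_mult_vec_eq[of _ n n]; use Sc in \<open>simp add: Sv id\<close>)+
  have Bc: "B \<in> carrier_mat n n" "B' \<in> carrier_mat n n"
    using B B' by (simp_all add: lattice_basis_def)
  have "\<exists>U\<in>carrier_mat n n. S * B = B' * U"
  proof (rule lattice_basis_factor[OF B'])
    fix j assume j: "j < n"
    have cj: "col B j \<in> carrier_vec n" by (rule col_carrier_vec[OF j Bc(1)])
    have "col (S * B) j = permute_vec n \<tau> (col B j)"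
      using Sv(1)[OF cj] Sc Bc j by (simp add: col_mult2)
    then show "red n (col (S * B) j) \<in> W'" using lattice_basis_col[OF B j] iff[OF cj] by simp
  qed (use Sc Bc in auto)
  then obtain U where U: "U \<in> carrier_mat n n" "S * B = B' * U" by blast
  have "\<exists>V\<in>carrier_mat n n. S' * B' = B * V"
  proof (rule lattice_basis_factor[OF B])
    fix j assume j: "j < n"
    have cj: "col B' j \<in> carrier_vec n" by (rule col_carrier_vec[OF j Bc(2)])
    have "col (S' * B') j = permute_vec n \<tau>' (col B' j)"
      using Sv(2)[OF cj] Sc Bc j by (simp add: col_mult2)
    then show "red n (col (S' * B') j) \<in> W"
      using lattice_basis_col[OF B' j] iff[of "permute_vec n \<tau>' (col B' j)"] id(1)[OF cj] by simp
  qed (use Sc Bc in auto)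
  then obtain V where V: "V \<in> carrier_mat n n" "S' * B' = B * V" by blast
  have det: "det B \<noteq> 0" "det B' \<noteq> 0"
    using lattice_basis_half_inverse[OF W B] lattice_basis_half_inverse[OF W' B'] by metis+
  have "B' * (U * V) = S * B * V" unfolding U(2) using U(1) V(1) Bc by simp
  also have "\<dots> = S * (S' * B')" unfolding V(2) using Sc V(1) Bc by simp
  also have "\<dots> = S * S' * B'" using Sc Bc by simp
  finally have "B' * (U * V) = B' * 1\<^sub>m n" using Bc by (simp add: SS')
  then have UV: "U * V = 1\<^sub>m n"
    by (rule mult_mat_left_cancel[OF Bc(2) det(2), rotated -1]) (use U V in auto)
  have one: "1 \<cdot>\<^sub>m 1\<^sub>m n = (1\<^sub>m n :: int mat)" by (rule eq_matI) auto
  from UV have VU: "V * U = 1\<^sub>m n"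
    using mult_eq_smult_one_commute[OF U(1) V(1), of 1] by (simp add: one)
  have UG: "U \<in> carrier (GL TYPE(int) n)" "V \<in> carrier (GL TYPE(int) n)"
    using U V UV VU by (auto simp: carrier_GL)
  have inv: "inv\<^bsub>GL TYPE(int) n\<^esub> U = V" "inv\<^bsub>GL TYPE(int) n\<^esub> V = U"
    by (rule group.inv_equality[OF group_GL]; use UG UV VU in \<open>simp add: mult_GL one_GL\<close>)+
  have "U * A * V \<in> integral_conj n B'" if "A \<in> integral_conj n B" for A
    by (rule integral_conj_transport[OF Sc(1) Bc(1,2) V(1) UG(1) inv(1)[symmetric] U(2) _ that])
      (unfold S_def, rule permutation_matrix_conj_sign_mat[OF \<tau>])
  moreover have "V * A * U \<in> integral_conj n B" if "A \<in> integral_conj n B'" for A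
    by (rule integral_conj_transport[OF Sc(2) Bc(2,1) U(1) UG(2) inv(2)[symmetric] V(2) _ that])
      (unfold S'_def, rule permutation_matrix_conj_sign_mat[OF \<tau>'])
  moreover have "A = U * (V * A * U) * V" if "A \<in> integral_conj n B'" for A
  proof -
    have A: "A \<in> carrier_mat n n" using that by (auto simp: integral_conj_def carrier_GL)
    have "U * (V * A * U) * V = (U * V) * A * (U * V)"
      using U(1) V(1) A by (simp add: assoc_mult_mat[of _ n n _ n _ n] mult_carrier_mat[of _ n n _ n])
    then show ?thesis using A by (simp add: UV)
  qed
  ultimately have "integral_conj n B' = (\<lambda>A. U * A * V) ` integral_conj n B"
    by blast
  then show ?thesis using UG(1) inv(1) by auto
qed

section \<open>From conjugate images back to equivalent subgroups\<close>

lemma mult_mat_vec_left_cancel: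
  fixes B :: "'a::idom mat"
  assumes B: "B \<in> carrier_mat n n" and "det B \<noteq> 0"
    and x: "x \<in> carrier_vec n" and y: "y \<in> carrier_vec n" and eq: "B *\<^sub>v x = B *\<^sub>v y"
  shows "x = y"
proof -
  have *: "adj_mat B *\<^sub>v (B *\<^sub>v z) = det B \<cdot>\<^sub>v z" if "z \<in> carrier_vec n" for z
    using adj_mat[OF B] that B
    by (simp flip: assoc_mult_mat_vec[of _ n n _ n]) (auto intro!: eq_vecI)
  have "det B \<cdot>\<^sub>v x = det B \<cdot>\<^sub>v y"
    using *[OF x] *[OF y] eq by simp
  then have "det B * x $ i = det B * y $ i" if "i < n" for i
    using that x y by (metis carrier_vecD index_smult_vec(1))
  then show ?thesis
    using x y \<open>det B \<noteq> 0\<close> by (intro eq_vecI) auto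
qed

lemma smult_mat_mult_vec:
  fixes A :: "'a::comm_semiring_0 mat"
  assumes "A \<in> carrier_mat n m" "v \<in> carrier_vec m"
  shows "(k \<cdot>\<^sub>m A) *\<^sub>v v = k \<cdot>\<^sub>v (A *\<^sub>v v)"
  using assms by (intro eq_vecI) auto

text \<open>The entry -1 occurs \<open>n - 1\<close> times, an even number: this is the source of
  the parity hypothesis.\<close>

lemma reflection_in_sign_mats:
  assumes "odd n" "i < n"
  shows "mat_diag n (\<lambda>j. if j = i then 1 else -1) \<in> sign_mats n"
proof -
  have "(\<Prod>j<n. if j = i then 1 else - 1 :: int) = (\<Prod>j\<in>{..<n} - {i}. - 1)"
    using \<open>i < n\<close> by (subst prod.remove[of _ i]) (auto intro: prod.cong)
  also have "\<dots> = 1" using assms by simp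
  finally show ?thesis
    unfolding sign_mats_def by (intro CollectI exI[of _ "\<lambda>j. if j = i then 1 else -1"]) simp
qed

text \<open>Two nonzero entries of row \<open>j\<close>, in columns \<open>i\<close> and
  \<open>k\<close>, would force the \<open>j\<close>-th sign of \<open>d'\<close> to be both 1 and
  -1. Nonsingularity excludes zero rows and columns, so sending a row to the column of its nonzero
  entry is onto, hence a permutation.\<close>

lemma monomial_if_normalizes_sign_mats:
  fixes N :: "int mat"
  assumes "odd n" and N: "N \<in> carrier_mat n n" "det N \<noteq> 0"
    and norm: "\<And>d. d \<in> sign_mats n \<Longrightarrow> \<exists>d'\<in>sign_mats n. N * d = d' * N"
  shows "\<exists>\<tau> a. \<tau> permutes {..<n} \<and> (\<forall>i<n. \<forall>j<n. N $$ (i, j) = (if j = \<tau> i then a i else 0))"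
proof -
  \<comment> \<open>Compare \<open>N d\<close> and \<open>d' N\<close> in row \<open>j\<close>, for the reflection \<open>d\<close> whose entry 1 is at \<open>i\<close>.\<close>
  have unique: "k = i" if "j < n" "i < n" "k < n" "N $$ (j, i) \<noteq> 0" "N $$ (j, k) \<noteq> 0" for i j k
  proof (rule ccontr)
    assume "k \<noteq> i"
    define s where "s j = (if j = i then 1 else -1 :: int)" for j
    have "mat_diag n s \<in> sign_mats n"
      unfolding s_def by (rule reflection_in_sign_mats[OF \<open>odd n\<close> \<open>i < n\<close>])
    then obtain s' where eq: "N * mat_diag n s = mat_diag n s' * N"
      using norm unfolding sign_mats_def by blast
    have "N $$ (j, l) * s l = s' j * N $$ (j, l)" if "l < n" for l
      using arg_cong[OF eq[unfolded mat_diag_mult_left[OF N(1)] mat_diag_mult_right[OF N(1)]],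
          of "\<lambda>A. A $$ (j, l)"] \<open>j < n\<close> that by simp
    from this[OF \<open>i < n\<close>] this[OF \<open>k < n\<close>] that \<open>k \<noteq> i\<close> show False
      by (simp add: s_def)
  qed
  have adj: "N * adj_mat N = det N \<cdot>\<^sub>m 1\<^sub>m n" "adj_mat N * N = det N \<cdot>\<^sub>m 1\<^sub>m n"
    "adj_mat N \<in> carrier_mat n n" using adj_mat[OF N(1)] by auto
  have row: "\<exists>j<n. N $$ (i, j) \<noteq> 0" if "i < n" for i
  proof (rule ccontr)
    assume "\<not> ?thesis"
    then have "row N i = 0\<^sub>v n" using N that by auto
    then have "(N * adj_mat N) $$ (i, i) = 0" using N that adj(3) by simp
    then show False using adj(1) that N by simp
  qed
  have col: "\<exists>i<n. N $$ (i, j) \<noteq> 0" if "j < n" for j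
  proof (rule ccontr)
    assume "\<not> ?thesis"
    then have "col N j = 0\<^sub>v n" using N that by auto
    then have "(adj_mat N * N) $$ (j, j) = 0" using N that adj(3) by simp
    then show False using adj(2) that N by simp
  qed
  obtain t where t: "\<And>i. i < n \<Longrightarrow> t i < n \<and> N $$ (i, t i) \<noteq> 0" using row by metis
  define \<tau> where "\<tau> i = (if i < n then t i else i)" for i
  have "\<tau> ` {..<n} = {..<n}"
  proof (intro subset_antisym image_subsetI subsetI)
    fix j assume "j \<in> {..<n}"
    then obtain i where "i < n" "N $$ (i, j) \<noteq> 0" using col by auto
    then have "\<tau> i = j" using unique[of i "t i" j] t[of i] \<open>j \<in> {..<n}\<close> by (simp add: \<tau>_def)
    then show "j \<in> \<tau> ` {..<n}" using \<open>i < n\<close> by auto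
  qed (use t in \<open>auto simp: \<tau>_def\<close>)
  then have "bij_betw \<tau> {..<n} {..<n}"
    by (simp add: bij_betw_def eq_card_imp_inj_on)
  then have "\<tau> permutes {..<n}"
    by (rule bij_imp_permutes) (simp add: \<tau>_def)
  moreover have "N $$ (i, j) = (if j = \<tau> i then N $$ (i, t i) else 0)" if "i < n" "j < n" for i j
    using unique[of i "t i" j] t[of i] that by (cases "j = \<tau> i") (simp_all add: \<tau>_def, metis)
  ultimately show ?thesis
    by (intro exI[of _ \<tau>] exI[of _ "\<lambda>i. N $$ (i, t i)"]) simp
qed

text \<open>As no generator lies in \<open>W\<close> or \<open>W'\<close>, both lattices meet each
  coordinate axis exactly in the even multiples of its unit vector. A monomial map between them
  therefore cannot scale an axis by a half-integral or an even factor.\<close>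

lemma Sub_equiv_if_conj:
  assumes "odd n" and W: "subgroup W (Z2_pow n)" and W': "subgroup W' (Z2_pow n)"
    and t: "\<forall>i\<in>{1..n}. t_gen n i \<notin> W" and t': "\<forall>i\<in>{1..n}. t_gen n i \<notin> W'"
    and B: "lattice_basis n W B" and B': "lattice_basis n W' B'"
    and U: "U \<in> carrier (GL TYPE(int) n)"
    and conj: "integral_conj n B' = (\<lambda>A. U * A * inv\<^bsub>GL TYPE(int) n\<^esub> U) ` integral_conj n B"
  shows "(W, W') \<in> Sub_equiv n"
proof -
  note assoc = assoc_mult_mat[of _ n n _ n _ n] mult_carrier_mat[of _ n n _ n]
  define V where "V = inv\<^bsub>GL TYPE(int) n\<^esub> U"
  have UV: "U * V = 1\<^sub>m n" "V * U = 1\<^sub>m n" and Vc: "V \<in> carrier_mat n n"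
    using GL_inv[OF U] by (auto simp: V_def)
  have Uc: "U \<in> carrier_mat n n" by (rule GL_carrier_mat[OF U])
  have Bc: "B \<in> carrier_mat n n" "B' \<in> carrier_mat n n"
    using B B' by (simp_all add: lattice_basis_def)
  obtain C where C: "C \<in> carrier_mat n n" "B * C = 2 \<cdot>\<^sub>m 1\<^sub>m n" "C * B = 2 \<cdot>\<^sub>m 1\<^sub>m n" "det B \<noteq> 0"
    using lattice_basis_half_inverse[OF W B] .
  have detB': "det B' \<noteq> 0" by (rule lattice_basis_half_inverse[OF W' B'])
  define N where "N = B' * U * C"
  have Nc: "N \<in> carrier_mat n n" unfolding N_def using Bc Uc C by simp
  have NB: "N * B = 2 \<cdot>\<^sub>m (B' * U)"
  proof -
    have "N * B = B' * U * (C * B)" unfolding N_def using Bc Uc C(1) by (simp add: assoc)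
    also have "\<dots> = 2 \<cdot>\<^sub>m (B' * U)"
      unfolding C(3) using Bc Uc by (simp add: mult_smult_distrib[of _ n n _ n])
    finally show ?thesis .
  qed
  have "det N \<noteq> 0"
  proof -
    have "det U \<noteq> 0" using det_mult[OF Uc Vc] UV by auto
    moreover have "det C \<noteq> 0" by (rule det_nonzero_if_mult_eq_smult_one[OF Bc(1) C(1,2)]) simp
    ultimately show ?thesis
      unfolding N_def using detB' Bc Uc C(1) by (simp add: det_mult[of _ n])
  qed
  \<comment> \<open>\<open>N\<close> is twice the rational matrix \<open>B' U B\<^sup>-\<^sup>1\<close>, which maps the lattice of \<open>W\<close> onto that of \<open>W'\<close>.\<close>
  have key: "red n x \<in> W \<longleftrightarrow> red n y \<in> W'"
    if x: "x \<in> carrier_vec n" and y: "y \<in> carrier_vec n" and xy: "N *\<^sub>v x = 2 \<cdot>\<^sub>v y" for x y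
  proof
    assume "red n x \<in> W"
    then obtain c where c: "c \<in> carrier_vec n" "x = B *\<^sub>v c"
      using B x by (auto simp: lattice_basis_def)
    have "2 \<cdot>\<^sub>v y = (N * B) *\<^sub>v c" using xy c Nc Bc by simp
    also have "\<dots> = 2 \<cdot>\<^sub>v (B' *\<^sub>v (U *\<^sub>v c))"
      unfolding NB using c Bc Uc by (simp add: smult_mat_mult_vec[of _ n n])
    finally have eq: "2 \<cdot>\<^sub>v y = 2 \<cdot>\<^sub>v (B' *\<^sub>v (U *\<^sub>v c))" .
    have "y = B' *\<^sub>v (U *\<^sub>v c)"
    proof (rule eq_vecI)
      fix i assume "i < dim_vec (B' *\<^sub>v (U *\<^sub>v c))"
      then show "y $ i = (B' *\<^sub>v (U *\<^sub>v c)) $ i"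
        using arg_cong[OF eq, of "\<lambda>v. v $ i"] y Bc by simp
    qed (use y Bc in simp)
    then show "red n y \<in> W'" using B' y c Uc by (auto simp: lattice_basis_def)
  next
    assume "red n y \<in> W'"
    then obtain c where c: "c \<in> carrier_vec n" "y = B' *\<^sub>v c"
      using B' y by (auto simp: lattice_basis_def)
    have Vcc: "V *\<^sub>v c \<in> carrier_vec n" using c Vc by simp
    have "N *\<^sub>v (B *\<^sub>v (V *\<^sub>v c)) = (N * B) *\<^sub>v (V *\<^sub>v c)" using Vcc Nc Bc by simp
    also have "\<dots> = 2 \<cdot>\<^sub>v (B' *\<^sub>v (U *\<^sub>v (V *\<^sub>v c)))"
      unfolding NB using Vcc Bc Uc by (simp add: smult_mat_mult_vec[of _ n n])
    also have "U *\<^sub>v (V *\<^sub>v c) = c"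
      using c Uc Vc UV by (simp flip: assoc_mult_mat_vec[of _ n n _ n])
    finally have "N *\<^sub>v x = N *\<^sub>v (B *\<^sub>v (V *\<^sub>v c))" using xy c by simp
    then have "x = B *\<^sub>v (V *\<^sub>v c)"
      by (rule mult_mat_vec_left_cancel[OF Nc \<open>det N \<noteq> 0\<close> x, rotated -1]) (use Vcc Bc in simp)
    then show "red n x \<in> W" using B x Vcc by (auto simp: lattice_basis_def)
  qed
  \<comment> \<open>Lift \<open>d\<close> through \<open>B\<close>, conjugate the lift by
    \<open>U\<close>, and read the result through \<open>B'\<close> as a sign matrix
    \<open>d'\<close>.\<close>
  have norm: "\<exists>d'\<in>sign_mats n. N * d = d' * N" if d: "d \<in> sign_mats n" for d
  proof -
    obtain A where A: "A \<in> carrier (GL TYPE(int) n)" "B * A = d * B"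
      using sign_mat_lift[OF W B d] by blast
    then have "U * A * V \<in> integral_conj n B'"
      unfolding conj V_def using d by (auto simp: integral_conj_def)
    then obtain d' where d': "d' \<in> sign_mats n" "B' * (U * A * V) = d' * B'"
      by (auto simp: integral_conj_def)
    note c = Bc Uc Vc Nc GL_carrier_mat[OF A(1)] sign_mats_carrier[OF d] sign_mats_carrier[OF d'(1)]
    have "B' * U * A = B' * U * A * (V * U)" using c UV by (simp add: assoc)
    also have "\<dots> = B' * (U * A * V) * U" using c by (simp add: assoc)
    also have "\<dots> = d' * (B' * U)" unfolding d'(2) using c by (simp add: assoc)
    finally have BUA: "B' * U * A = d' * (B' * U)" .
    have "N * d * B = N * B * A" using c A(2) by (simp add: assoc)
    also have "\<dots> = 2 \<cdot>\<^sub>m (B' * U * A)"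
      unfolding NB using c by (simp add: mult_smult_assoc_mat[of _ n n _ n] assoc)
    also have "\<dots> = d' * (N * B)"
      unfolding BUA NB using c by (simp add: mult_smult_distrib[of _ n n _ n] assoc)
    also have "\<dots> = d' * N * B" using c by (simp add: assoc)
    finally have "N * d * B = d' * N * B" .
    then have "N * d = d' * N"
      by (rule mult_mat_right_cancel[OF Bc(1) C(4), rotated -1]) (use c in auto)
    then show ?thesis using d' by blast
  qed
  obtain \<tau> a where \<tau>: "\<tau> permutes {..<n}"
    and N: "\<And>i j. i < n \<Longrightarrow> j < n \<Longrightarrow> N $$ (i, j) = (if j = \<tau> i then a i else 0)"
    using monomial_if_normalizes_sign_mats[OF \<open>odd n\<close> Nc \<open>det N \<noteq> 0\<close> norm] by blast
  have \<tau>n: "\<tau> i < n" if "i < n" for i using that permutes_lessThan_iff[OF \<tau>] by simp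
  have Nv: "N *\<^sub>v x = vec n (\<lambda>i. a i * x $ \<tau> i)" if x: "x \<in> carrier_vec n" for x
  proof (rule eq_vecI)
    fix i assume "i < dim_vec (vec n (\<lambda>i. a i * x $ \<tau> i))"
    then have i: "i < n" by simp
    have "row N i = a i \<cdot>\<^sub>v unit_vec n (\<tau> i)"
      using i N Nc \<tau>n[OF i] by (intro eq_vecI) (auto simp: unit_vec_def)
    then show "(N *\<^sub>v x) $ i = vec n (\<lambda>i. a i * x $ \<tau> i) $ i"
      using i Nc x \<tau>n[OF i] by simp
  qed (use Nc in simp)
  have Nunit: "N *\<^sub>v unit_vec n (\<tau> j) = a j \<cdot>\<^sub>v unit_vec n j" if "j < n" for j
  proof -
    have "\<tau> i = \<tau> j \<longleftrightarrow> i = j" for i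
      using permutes_inj[OF \<tau>] by (auto dest: injD)
    then show ?thesis
      using that \<tau>n by (auto simp: Nv unit_vec_def)
  qed
  \<comment> \<open>The scaling factor \<open>a j / 2\<close> is integral: twice the unit vector at
    \<open>\<tau> j\<close> is in the first lattice and goes to \<open>a j\<close> times the one at
    \<open>j\<close>, which for odd \<open>a j\<close> would reduce to a generator in
    \<open>W'\<close>.\<close>
  have even_a: "even (a j)" if j: "j < n" for j
  proof (rule ccontr)
    assume "odd (a j)"
    have "N *\<^sub>v (2 \<cdot>\<^sub>v unit_vec n (\<tau> j)) = 2 \<cdot>\<^sub>v (a j \<cdot>\<^sub>v unit_vec n j)"
      by (simp add: mult_mat_smult_vec[OF Nc] Nunit[OF j])
    then have "red n (2 \<cdot>\<^sub>v unit_vec n (\<tau> j)) \<in> W \<longleftrightarrow> red n (a j \<cdot>\<^sub>v unit_vec n j) \<in> W'"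
      by (intro key) auto
    moreover have "red n (2 \<cdot>\<^sub>v unit_vec n (\<tau> j)) = \<one>\<^bsub>Z2_pow n\<^esub>"
      by (simp add: red_eq_one_iff)
    moreover have "red n (a j \<cdot>\<^sub>v unit_vec n j) = red n (unit_vec n j)"
      using \<open>odd (a j)\<close> by (auto simp: red_eq_iff unit_vec_def odd_iff_mod_2_eq_one)
    ultimately have "t_gen n (Suc j) \<in> W'"
      using j subgroup.one_closed[OF W] by (simp add: red_unit_vec)
    then show False using t' j by auto
  qed
  \<comment> \<open>With an even factor the unit vector at \<open>\<tau> j\<close> would land in the
    second lattice, so its generator would lie in \<open>W\<close>.\<close>
  have odd_b: "odd (a j div 2)" if j: "j < n" for j
  proof
    assume "even (a j div 2)"
    have "N *\<^sub>v unit_vec n (\<tau> j) = 2 \<cdot>\<^sub>v ((a j div 2) \<cdot>\<^sub>v unit_vec n j)"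
      using even_a[OF j] by (simp add: Nunit[OF j] smult_smult_assoc)
    then have "red n (unit_vec n (\<tau> j)) \<in> W \<longleftrightarrow> red n ((a j div 2) \<cdot>\<^sub>v unit_vec n j) \<in> W'"
      by (intro key) auto
    moreover have "red n ((a j div 2) \<cdot>\<^sub>v unit_vec n j) = \<one>\<^bsub>Z2_pow n\<^esub>"
      using \<open>even (a j div 2)\<close> by (simp add: red_eq_one_iff)
    ultimately have "t_gen n (Suc (\<tau> j)) \<in> W"
      using \<tau>n[OF j] subgroup.one_closed[OF W'] by (simp add: red_unit_vec)
    then show False using t \<tau>n[OF j] by auto
  qed
  have "red n x \<in> W \<longleftrightarrow> red n (permute_vec n \<tau> x) \<in> W'" if x: "x \<in> carrier_vec n" for x
  proof -
    define y where "y = vec n (\<lambda>i. (a i div 2) * x $ \<tau> i)"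
    have "N *\<^sub>v x = 2 \<cdot>\<^sub>v y"
      using x even_a by (auto simp: Nv y_def)
    then have "red n x \<in> W \<longleftrightarrow> red n y \<in> W'"
      by (intro key) (auto simp: x y_def)
    also have "red n y = red n (permute_vec n \<tau> x)"
    proof -
      have "(b * c) mod 2 = c mod 2" if "odd b" for b c :: int
        using that by (metis mod_mult_left_eq mult_1 odd_iff_mod_2_eq_one)
      then show ?thesis using odd_b by (simp add: red_eq_iff y_def permute_vec_def)
    qed
    finally show ?thesis .
  qed
  then show ?thesis using \<tau> by (auto simp: Sub_equiv_iff[OF W W'])
qed

subsection \<open>Rationally equivalent representations\<close>

lemma common_denominator_mat:
  fixes P :: "rat mat"
  shows "\<exists>k B. k > 0 \<and> map_mat rat_of_int B = rat_of_int k \<cdot>\<^sub>m P"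
proof -
  define den where "den ij = snd (quotient_of (P $$ ij))" for ij
  define I where "I = {..<dim_row P} \<times> {..<dim_col P}"
  have I: "finite I" by (simp add: I_def)
  define k where "k = prod den I"
  have den: "den ij > 0" for ij by (simp add: den_def quotient_of_denom_pos')
  have "\<exists>b. rat_of_int b = rat_of_int k * P $$ ij" if "ij \<in> I" for ij
  proof -
    obtain p q where pq: "quotient_of (P $$ ij) = (p, q)" by force
    have "P $$ ij = rat_of_int p / rat_of_int q" "q > 0" "q = den ij"
      using quotient_of_div[OF pq] quotient_of_denom_pos[OF pq] pq by (simp_all add: den_def)
    moreover have "k = den ij * prod den (I - {ij})"
      unfolding k_def by (rule prod.remove[OF I that])
    ultimately have "rat_of_int (p * prod den (I - {ij})) = rat_of_int k * P $$ ij" by simp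
    then show ?thesis by blast
  qed
  then obtain b where b: "\<And>ij. ij \<in> I \<Longrightarrow> rat_of_int (b ij) = rat_of_int k * P $$ ij" by metis
  have "map_mat rat_of_int (mat (dim_row P) (dim_col P) b) = rat_of_int k \<cdot>\<^sub>m P"
    using b by (intro eq_matI) (auto simp: I_def)
  moreover have "k > 0" unfolding k_def using den by (simp add: prod_pos)
  ultimately show ?thesis by blast
qed

lemma map_mat_of_int_inject:
  "map_mat rat_of_int A = map_mat rat_of_int B \<longleftrightarrow> A = B"
proof
  assume eq: "map_mat rat_of_int A = map_mat rat_of_int B"
  have dims: "dim_row A = dim_row B" "dim_col A = dim_col B"
    using arg_cong[OF eq, of dim_row] arg_cong[OF eq, of dim_col] by auto
  show "A = B"
  proof (rule eq_matI)
    fix i j assume "i < dim_row B" "j < dim_col B"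
    then show "A $$ (i, j) = B $$ (i, j)"
      using arg_cong[OF eq, of "\<lambda>M. M $$ (i, j)"] dims by simp
  qed (use dims in auto)
qed simp

text \<open>Clearing denominators makes the conjugating matrix integral; a scalar factor does not
  affect the intertwining equation.\<close>

lemma rationally_equivalent_intertwiner:
  assumes "rationally_equivalent n G \<rho> \<rho>'"
    and c: "\<And>g. g \<in> carrier G \<Longrightarrow> \<rho> g \<in> carrier_mat n n \<and> \<rho>' g \<in> carrier_mat n n"
  shows "\<exists>B\<in>carrier_mat n n. det B \<noteq> 0 \<and> (\<forall>g\<in>carrier G. B * \<rho> g = \<rho>' g * B)"
proof -
  let ?i = "map_mat rat_of_int"
  obtain P where P: "P \<in> carrier (GL TYPE(rat) n)"
    and eq: "\<And>g. g \<in> carrier G \<Longrightarrow> ?i (\<rho>' g) = P * ?i (\<rho> g) * inv\<^bsub>GL TYPE(rat) n\<^esub> P"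
    using assms(1) by (auto simp: rationally_equivalent_def mult_GL)
  have Pc: "P \<in> carrier_mat n n" by (rule GL_carrier_mat[OF P])
  note inv = GL_inv[OF P]
  obtain k B where kB: "k > 0" "?i B = rat_of_int k \<cdot>\<^sub>m P"
    using common_denominator_mat by blast
  have Bc: "B \<in> carrier_mat n n"
    using arg_cong[OF kB(2), of dim_row] arg_cong[OF kB(2), of dim_col] Pc by auto
  have "det P \<noteq> 0" using det_mult[OF Pc inv(1)] inv(2) by auto
  then have "det (?i B) \<noteq> 0" using kB by (simp add: det_smult)
  then have "det B \<noteq> 0" by (simp add: of_int_hom.hom_det)
  moreover have "B * \<rho> g = \<rho>' g * B" if g: "g \<in> carrier G" for g
  proof -
    have cg: "\<rho> g \<in> carrier_mat n n" "\<rho>' g \<in> carrier_mat n n" using c[OF g] by auto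
    have "?i (\<rho>' g) * P = P * ?i (\<rho> g) * (inv\<^bsub>GL TYPE(rat) n\<^esub> P * P)"
      unfolding eq[OF g] using cg Pc inv(1)
      by (simp add: assoc_mult_mat[of _ n n _ n _ n] mult_carrier_mat[of _ n n _ n])
    then have "?i (\<rho>' g) * P = P * ?i (\<rho> g)"
      using cg Pc by (simp add: inv(3))
    then have "?i (\<rho>' g * B) = ?i (B * \<rho> g)"
      using cg Bc Pc
      by (simp add: of_int_hom.mat_hom_mult[of _ n n _ n] kB(2) mult_smult_distrib[of _ n n _ n]
          mult_smult_assoc_mat[of _ n n _ n])
    then show ?thesis by (simp add: map_mat_of_int_inject)
  qed
  ultimately show ?thesis using Bc by blast
qed

text \<open>The lattice spanned by \<open>B\<^sub>0\<close> meets axis \<open>i\<close> in the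
  multiples of some \<open>a i\<close>. Multiplying coordinate \<open>i\<close> by
  \<open>2 / a i\<close> makes 2 the generator on every axis, so \<open>B\<close> is twice the
  inverse of \<open>mat_diag n a\<close> times \<open>B\<^sub>0\<close>.\<close>

lemma rescale_invariant_lattice:
  fixes B\<^sub>0 :: "int mat"
  assumes "odd n" and B\<^sub>0: "B\<^sub>0 \<in> carrier_mat n n" "det B\<^sub>0 \<noteq> 0"
    and inv: "\<And>d. d \<in> sign_mats n \<Longrightarrow> \<exists>A\<in>carrier_mat n n. B\<^sub>0 * A = d * B\<^sub>0"
  shows "\<exists>a B W. (\<forall>i<n. a i > 0) \<and> mat_diag n a * B = 2 \<cdot>\<^sub>m B\<^sub>0 \<and>
    subgroup W (Z2_pow n) \<and> (\<forall>i\<in>{1..n}. t_gen n i \<notin> W) \<and> lattice_basis n W B"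
proof -
  define S where "S i = {a. \<exists>c\<in>carrier_vec n. B\<^sub>0 *\<^sub>v c = a \<cdot>\<^sub>v unit_vec n i}" for i
  have S_diff: "x - y \<in> S i" if xy: "x \<in> S i" "y \<in> S i" for x y i
  proof -
    obtain c c' where c: "c \<in> carrier_vec n" "c' \<in> carrier_vec n"
      "B\<^sub>0 *\<^sub>v c = x \<cdot>\<^sub>v unit_vec n i" "B\<^sub>0 *\<^sub>v c' = y \<cdot>\<^sub>v unit_vec n i"
      using xy by (auto simp: S_def)
    have "B\<^sub>0 *\<^sub>v (c - c') = x \<cdot>\<^sub>v unit_vec n i - y \<cdot>\<^sub>v unit_vec n i"
      using c by (simp add: mult_minus_distrib_mat_vec[OF B\<^sub>0(1)])
    also have "\<dots> = (x - y) \<cdot>\<^sub>v unit_vec n i"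
      by (rule eq_vecI) (auto simp: unit_vec_def)
    finally show ?thesis
      unfolding S_def using c(1,2) by (intro CollectI bexI[of _ "c - c'"]) auto
  qed
  have "\<exists>m>0. m \<in> S i" if i: "i < n" for i
  proof -
    \<comment> \<open>The adjugate puts \<open>det B\<^sub>0\<close> times the unit vector into the
      lattice; the sign makes the multiple positive.\<close>
    let ?c = "sgn (det B\<^sub>0) \<cdot>\<^sub>v (adj_mat B\<^sub>0 *\<^sub>v unit_vec n i)"
    have adj: "adj_mat B\<^sub>0 \<in> carrier_mat n n" "B\<^sub>0 * adj_mat B\<^sub>0 = det B\<^sub>0 \<cdot>\<^sub>m 1\<^sub>m n"
      using adj_mat[OF B\<^sub>0(1)] by auto
    have "B\<^sub>0 *\<^sub>v (adj_mat B\<^sub>0 *\<^sub>v unit_vec n i) = (B\<^sub>0 * adj_mat B\<^sub>0) *\<^sub>v unit_vec n i"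
      using B\<^sub>0(1) adj(1) by simp
    also have "\<dots> = det B\<^sub>0 \<cdot>\<^sub>v unit_vec n i"
      unfolding adj(2) by (simp add: smult_mat_mult_vec[of _ n n])
    finally have "B\<^sub>0 *\<^sub>v ?c = \<bar>det B\<^sub>0\<bar> \<cdot>\<^sub>v unit_vec n i"
      using adj by (simp add: mult_mat_smult_vec[OF B\<^sub>0(1)] smult_smult_assoc abs_sgn mult.commute)
    moreover have "?c \<in> carrier_vec n" using adj by simp
    ultimately have "\<bar>det B\<^sub>0\<bar> \<in> S i" unfolding S_def by blast
    then show ?thesis using B\<^sub>0(2) by (metis zero_less_abs_iff)
  qed
  then have "\<exists>a>0. a \<in> S i \<and> (\<forall>x\<in>S i. a dvd x)" if "i < n" for i
    using that S_diff int_subgroup_generator[of _ "S i"] by metis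
  then obtain a where a: "\<And>i. i < n \<Longrightarrow> a i > 0" "\<And>i. i < n \<Longrightarrow> a i \<in> S i"
    "\<And>i x. i < n \<Longrightarrow> x \<in> S i \<Longrightarrow> a i dvd x" by metis
  \<comment> \<open>Integrality of \<open>B\<close>: a basis column plus its reflection is a lattice
    vector on axis \<open>i\<close>, with coordinate twice the entry.\<close>
  have dvd: "a i dvd 2 * B\<^sub>0 $$ (i, j)" if ij: "i < n" "j < n" for i j
  proof -
    define s where "s k = (if k = i then 1 else -1 :: int)" for k
    obtain A where A: "A \<in> carrier_mat n n" "B\<^sub>0 * A = mat_diag n s * B\<^sub>0"
      using inv[of "mat_diag n s"] reflection_in_sign_mats[OF \<open>odd n\<close> ij(1)]
      unfolding s_def by blast
    have cj: "col B\<^sub>0 j \<in> carrier_vec n" by (rule col_carrier_vec[OF ij(2) B\<^sub>0(1)])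
    have "B\<^sub>0 *\<^sub>v (unit_vec n j + A *\<^sub>v unit_vec n j) = col B\<^sub>0 j + (B\<^sub>0 * A) *\<^sub>v unit_vec n j"
      using A(1) B\<^sub>0 ij
      by (simp add: mult_add_distrib_mat_vec[OF B\<^sub>0(1)] mult_mat_unit_vec[of B\<^sub>0 n n])
    also have "(B\<^sub>0 * A) *\<^sub>v unit_vec n j = mat_diag n s *\<^sub>v col B\<^sub>0 j"
      unfolding A(2) using B\<^sub>0 ij
      by (simp add: assoc_mult_mat_vec[of _ n n _ n] mult_mat_unit_vec[of B\<^sub>0 n n])
    also have "\<dots> = vec n (\<lambda>k. s k * B\<^sub>0 $$ (k, j))"
      using mat_diag_mult_vec[OF cj] B\<^sub>0 ij by auto
    also have "col B\<^sub>0 j + \<dots> = (2 * B\<^sub>0 $$ (i, j)) \<cdot>\<^sub>v unit_vec n i"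
      using B\<^sub>0 ij by (intro eq_vecI) (auto simp: s_def)
    finally have "2 * B\<^sub>0 $$ (i, j) \<in> S i"
      unfolding S_def using A(1) by (intro CollectI bexI) auto
    then show ?thesis using a(3) ij by blast
  qed
  define B where "B = mat n n (\<lambda>(i, j). 2 * B\<^sub>0 $$ (i, j) div a i)"
  have Bc: "B \<in> carrier_mat n n" by (simp add: B_def)
  have aB: "mat_diag n a * B = 2 \<cdot>\<^sub>m B\<^sub>0"
    unfolding mat_diag_mult_left[OF Bc] using B\<^sub>0(1) dvd
    by (intro eq_matI) (auto simp: B_def)
  have aBv: "a i * (B *\<^sub>v c) $ i = 2 * (B\<^sub>0 *\<^sub>v c) $ i" if "c \<in> carrier_vec n" "i < n" for c i
  proof -
    have "mat_diag n a *\<^sub>v (B *\<^sub>v c) = (mat_diag n a * B) *\<^sub>v c"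
      using that Bc by (simp add: assoc_mult_mat_vec[of _ n n _ n])
    also have "\<dots> = 2 \<cdot>\<^sub>v (B\<^sub>0 *\<^sub>v c)"
      unfolding aB by (rule smult_mat_mult_vec[OF B\<^sub>0(1) that(1)])
    finally have eq: "vec n (\<lambda>i. a i * (B *\<^sub>v c) $ i) = 2 \<cdot>\<^sub>v (B\<^sub>0 *\<^sub>v c)"
      using Bc that by (simp add: mat_diag_mult_vec)
    show ?thesis using arg_cong[OF eq, of "\<lambda>v. v $ i"] that B\<^sub>0(1) by simp
  qed
  have "\<exists>V\<in>carrier_mat n n. 2 \<cdot>\<^sub>m 1\<^sub>m n = B * V"
  proof (rule eq_mult_mat_if_cols[OF Bc])
    fix j assume j: "j < n"
    obtain c where c: "c \<in> carrier_vec n" "B\<^sub>0 *\<^sub>v c = a j \<cdot>\<^sub>v unit_vec n j"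
      using a(2)[OF j] by (auto simp: S_def)
    have "(B *\<^sub>v c) $ i = 2 * unit_vec n j $ i" if "i < n" for i
    proof -
      have "a i * (B *\<^sub>v c) $ i = a i * (2 * unit_vec n j $ i)"
        using aBv[OF c(1) that] that by (simp add: c(2) unit_vec_def)
      then show ?thesis using a(1)[OF that] by simp
    qed
    then have "col (2 \<cdot>\<^sub>m 1\<^sub>m n) j = B *\<^sub>v c" using j Bc by (intro eq_vecI) auto
    then show "\<exists>c\<in>carrier_vec n. col (2 \<cdot>\<^sub>m 1\<^sub>m n) j = B *\<^sub>v c" using c by blast
  qed simp
  then obtain V where V: "V \<in> carrier_mat n n" "B * V = 2 \<cdot>\<^sub>m 1\<^sub>m n" by metis
  define W where "W = (\<lambda>c. red n (B *\<^sub>v c)) ` carrier_vec n"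
  have W: "subgroup W (Z2_pow n)"
  proof (rule subgroup_Z2_powI)
    show "W \<subseteq> carrier (Z2_pow n)" by (auto simp: W_def red_in_carrier)
    show "W \<noteq> {}" by (auto simp: W_def intro: zero_carrier_vec)
    fix f g assume "f \<in> W" "g \<in> W"
    then obtain c c' where c: "c \<in> carrier_vec n" "c' \<in> carrier_vec n"
      "f = red n (B *\<^sub>v c)" "g = red n (B *\<^sub>v c')" by (auto simp: W_def)
    then have "f \<otimes>\<^bsub>Z2_pow n\<^esub> g = red n (B *\<^sub>v (c - c'))"
      using Bc by (simp add: mult_minus_distrib_mat_vec[OF Bc] red_diff)
    then show "f \<otimes>\<^bsub>Z2_pow n\<^esub> g \<in> W" using c by (auto simp: W_def)
  qed
  \<comment> \<open>Membership depends only on the residue: vectors with equal residues differ by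
    some \<open>2 \<cdot>\<^sub>v z\<close>, which equals
    \<open>B *\<^sub>v (V *\<^sub>v z)\<close>.\<close>
  have basis: "red n x \<in> W \<longleftrightarrow> (\<exists>c\<in>carrier_vec n. x = B *\<^sub>v c)" if x: "x \<in> carrier_vec n" for x
  proof
    assume "red n x \<in> W"
    then obtain c where c: "c \<in> carrier_vec n" "red n x = red n (B *\<^sub>v c)" by (auto simp: W_def)
    have Bcc: "B *\<^sub>v c \<in> carrier_vec n" using Bc c by simp
    define z where "z = vec n (\<lambda>i. (x $ i - (B *\<^sub>v c) $ i) div 2)"
    have z: "z \<in> carrier_vec n" by (simp add: z_def)
    have "x $ i = (B *\<^sub>v c) $ i + 2 * z $ i" if "i < n" for i
    proof -
      have "x $ i mod 2 = (B *\<^sub>v c) $ i mod 2" using c(2) that unfolding red_eq_iff by blast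
      then have "2 dvd x $ i - (B *\<^sub>v c) $ i" by (simp add: mod_eq_dvd_iff)
      then show ?thesis using that by (simp add: z_def)
    qed
    then have "x = B *\<^sub>v c + 2 \<cdot>\<^sub>v z" using x z Bc by (intro eq_vecI) auto
    also have "2 \<cdot>\<^sub>v z = (B * V) *\<^sub>v z" unfolding V(2) using z by (simp add: smult_mat_mult_vec[of _ n n])
    also have "B *\<^sub>v c + (B * V) *\<^sub>v z = B *\<^sub>v (c + V *\<^sub>v z)"
      using c z V(1) Bc by (simp add: mult_add_distrib_mat_vec[OF Bc] assoc_mult_mat_vec[of _ n n _ n])
    finally show "\<exists>c\<in>carrier_vec n. x = B *\<^sub>v c"
      using c z V(1) by (intro bexI[of _ "c + V *\<^sub>v z"]) auto
  qed (auto simp: W_def)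
  have "t_gen n i \<notin> W" if i: "i \<in> {1..n}" for i
  proof
    assume "t_gen n i \<in> W"
    define k where "k = i - 1"
    have k: "k < n" "i = Suc k" using i by (auto simp: k_def)
    then have "red n (unit_vec n k) \<in> W" using \<open>t_gen n i \<in> W\<close> by (simp add: red_unit_vec)
    then obtain c where c: "c \<in> carrier_vec n" "unit_vec n k = B *\<^sub>v c"
      using basis[OF unit_vec_carrier] by blast
    \<comment> \<open>Undoing the rescaling, the original lattice would contain half of its
      generator \<open>a k\<close> on axis \<open>k\<close>.\<close>
    define q where "q = (B\<^sub>0 *\<^sub>v c) $ k"
    have *: "a j * unit_vec n k $ j = 2 * (B\<^sub>0 *\<^sub>v c) $ j" if "j < n" for j
      using aBv[OF c(1) that] by (simp add: c(2))
    have "(B\<^sub>0 *\<^sub>v c) $ j = q * unit_vec n k $ j" if "j < n" for j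
      using *[OF that] that k by (cases "j = k") (auto simp: q_def)
    then have "B\<^sub>0 *\<^sub>v c = q \<cdot>\<^sub>v unit_vec n k" using B\<^sub>0(1) by (intro eq_vecI) auto
    then have "a k dvd q" using a(3)[OF k(1)] c(1) by (auto simp: S_def)
    moreover have "a k = 2 * q" using *[OF k(1)] k by (simp add: q_def)
    ultimately show False using a(1)[OF k(1)] by (auto dest: zdvd_imp_le)
  qed
  with a(1) aB W Bc basis show ?thesis unfolding lattice_basis_def by blast
qed

text \<open>The rescaling matrix is diagonal and so commutes with sign matrices; hence the
  intertwining equation passes from \<open>B\<^sub>0\<close> to \<open>B\<close>.\<close>

lemma rational_image_is_integral_conj:
  assumes "odd n" and diag: "is_diag_rep n \<rho>\<^sub>d"
    and \<rho>: "\<rho> \<in> hom (Z2_pow (n - 1)) (GL TYPE(int) n)"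
    and eq: "rationally_equivalent n (Z2_pow (n - 1)) \<rho> \<rho>\<^sub>d"
  shows "\<exists>W B. subgroup W (Z2_pow n) \<and> (\<forall>i\<in>{1..n}. t_gen n i \<notin> W) \<and> lattice_basis n W B \<and>
    \<rho> ` carrier (Z2_pow (n - 1)) = integral_conj n B"
proof -
  let ?Z = "Z2_pow (n - 1)"
  note img = diag_rep_image[OF diag]
  have \<rho>G: "\<rho> g \<in> carrier (GL TYPE(int) n)" if "g \<in> carrier ?Z" for g
    by (rule hom_in_carrier[OF \<rho> that])
  have c: "\<rho> g \<in> carrier_mat n n" "\<rho>\<^sub>d g \<in> carrier_mat n n" if "g \<in> carrier ?Z" for g
    using GL_carrier_mat[OF \<rho>G[OF that]] img that sign_mats_carrier by blast+
  obtain B\<^sub>0 where B\<^sub>0: "B\<^sub>0 \<in> carrier_mat n n" "det B\<^sub>0 \<noteq> 0"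
    and inter: "\<And>g. g \<in> carrier ?Z \<Longrightarrow> B\<^sub>0 * \<rho> g = \<rho>\<^sub>d g * B\<^sub>0"
    using rationally_equivalent_intertwiner[OF eq] c by blast
  have "\<exists>A\<in>carrier_mat n n. B\<^sub>0 * A = d * B\<^sub>0" if d: "d \<in> sign_mats n" for d
  proof -
    obtain g where "g \<in> carrier ?Z" "d = \<rho>\<^sub>d g" using img d by blast
    then show ?thesis using c inter by blast
  qed
  then obtain a B W where a: "\<forall>i<n. a i > 0" and aB: "mat_diag n a * B = 2 \<cdot>\<^sub>m B\<^sub>0"
    and W: "subgroup W (Z2_pow n)" "\<forall>i\<in>{1..n}. t_gen n i \<notin> W" and B: "lattice_basis n W B"
    using rescale_invariant_lattice[OF \<open>odd n\<close> B\<^sub>0] by blast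
  have Bc: "B \<in> carrier_mat n n" using B by (simp add: lattice_basis_def)
  have detB: "det B \<noteq> 0" by (rule lattice_basis_half_inverse[OF W(1) B])
  have deta: "det (mat_diag n a) \<noteq> 0" using a by (auto simp: det_mat_diag)
  have B\<rho>: "B * \<rho> g = \<rho>\<^sub>d g * B" if g: "g \<in> carrier ?Z" for g
  proof -
    obtain s where s: "\<rho>\<^sub>d g = mat_diag n s" using img g by (auto simp: sign_mats_def)
    note assoc = assoc_mult_mat[of _ n n _ n _ n] mult_carrier_mat[of _ n n _ n]
    have "mat_diag n a * (B * \<rho> g) = mat_diag n a * B * \<rho> g"
      using Bc c[OF g] by (simp add: assoc)
    also have "\<dots> = 2 \<cdot>\<^sub>m (B\<^sub>0 * \<rho> g)"
      unfolding aB using B\<^sub>0 c[OF g] by (simp add: mult_smult_assoc_mat[of _ n n _ n])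
    also have "\<dots> = \<rho>\<^sub>d g * (mat_diag n a * B)"
      unfolding aB inter[OF g] using B\<^sub>0 c[OF g] by (simp add: mult_smult_distrib[of _ n n _ n])
    also have "\<dots> = mat_diag n s * mat_diag n a * B" 
      unfolding s by (rule assoc_mult_mat[symmetric, OF mat_diag_dim mat_diag_dim Bc])
    also have "\<dots> = mat_diag n a * (\<rho>\<^sub>d g * B)"
      unfolding s using Bc by (simp add: mult.commute flip: assoc_mult_mat[of _ n n _ n _ n])
    finally show ?thesis
      by (rule mult_mat_left_cancel[OF mat_diag_dim deta, rotated -1]) (use Bc c[OF g] in auto)
  qed
  have "\<rho> ` carrier ?Z = integral_conj n B"
  proof (intro subset_antisym image_subsetI subsetI)
    fix g assume g: "g \<in> carrier ?Z"
    then have "\<rho>\<^sub>d g \<in> sign_mats n" using img by blast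
    then show "\<rho> g \<in> integral_conj n B"
      unfolding integral_conj_def using \<rho>G[OF g] B\<rho>[OF g] by blast
  next
    fix A assume "A \<in> integral_conj n B"
    then obtain d where A: "A \<in> carrier_mat n n" "d \<in> sign_mats n" "B * A = d * B"
      by (auto simp: integral_conj_def carrier_GL)
    obtain g where g: "g \<in> carrier ?Z" "d = \<rho>\<^sub>d g" using img A(2) by blast
    have "A = \<rho> g"
      by (rule mult_mat_left_cancel[OF Bc detB A(1) c(1)[OF g(1)]]) (simp only: A(3) g(2) B\<rho>[OF g(1)])
    then show "A \<in> \<rho> ` carrier ?Z" using g by blast
  qed
  then show ?thesis using W B by blast
qed

theorem proposition1:
  fixes n :: nat and \<rho>_diag :: "(nat \<Rightarrow> int) \<Rightarrow> int mat"
  assumes "odd n" and "is_diag_rep n \<rho>_diag"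
  shows "\<exists>f. bij_betw f (Sub n) (image_classes n \<rho>_diag)"
  unfolding Sub_def image_classes_def
proof (rule quotient_bij_of_relation[OF equiv_Sub_equiv _ group.equiv_conj_subgroups[OF group_GL],
      where R = "\<lambda>W H. \<exists>B. lattice_basis n W B \<and> H = integral_conj n B"])
  let ?Z = "Z2_pow (n - 1)"
  let ?images = "{\<rho> ` carrier ?Z | \<rho>. \<rho> \<in> hom ?Z (GL TYPE(int) n) \<and> rationally_equivalent n ?Z \<rho> \<rho>_diag}"
  let ?subgroups = "{W. subgroup W (Z2_pow n) \<and> (\<forall>i\<in>{1..n}. t_gen n i \<notin> W)}"
  show "?subgroups \<subseteq> {W. subgroup W (Z2_pow n)}" by blast
  show sub: "?images \<subseteq> {H. subgroup H (GL TYPE(int) n)}"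
  proof clarify
    fix \<rho> assume "\<rho> \<in> hom ?Z (GL TYPE(int) n)"
    then have "group_hom ?Z (GL TYPE(int) n) \<rho>"
      by (simp add: group_hom_def group_hom_axioms_def group_Z2_pow group_GL)
    then show "subgroup (\<rho> ` carrier ?Z) (GL TYPE(int) n)"
      by (rule group_hom.img_is_subgroup)
  qed
  show "\<exists>H\<in>?images. \<exists>B. lattice_basis n W B \<and> H = integral_conj n B" if "W \<in> ?subgroups" for W
  proof -
    have W: "subgroup W (Z2_pow n)" using that by blast
    obtain B where B: "lattice_basis n W B" using ex_lattice_basis[OF W] by blast
    show ?thesis using integral_conj_is_image[OF W B assms(2)] B by blast
  qed
  show "\<exists>W\<in>?subgroups. \<exists>B. lattice_basis n W B \<and> H = integral_conj n B" if "H \<in> ?images" for H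
    using that rational_image_is_integral_conj[OF assms] by blast
  fix W W' H H'
  assume W: "W \<in> ?subgroups" "W' \<in> ?subgroups" and H: "H \<in> ?images" "H' \<in> ?images"
    and "\<exists>B. lattice_basis n W B \<and> H = integral_conj n B"
    and "\<exists>B. lattice_basis n W' B \<and> H' = integral_conj n B"
  then obtain B B' where B: "lattice_basis n W B" "H = integral_conj n B"
    "lattice_basis n W' B'" "H' = integral_conj n B'" by blast
  have sgr: "subgroup H (GL TYPE(int) n)" "subgroup H' (GL TYPE(int) n)" using H sub by blast+
  \<comment> \<open>Since \<open>B\<close> and \<open>B'\<close> are arbitrary bases, this
    equivalence also settles that the class of \<open>H\<close> does not depend on the
    basis.\<close>
  show "(W, W') \<in> Sub_equiv n \<longleftrightarrow> (H, H') \<in> conj_subgroups (GL TYPE(int) n)"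
    unfolding conj_subgroups_iff mult_GL
    using conj_if_Sub_equiv[of W n W' B B'] Sub_equiv_if_conj[OF assms(1), of W W' B B'] W B sgr
    by blast
qed

end
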